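(* There is an active (adaptive) ranking algorithm, which does not know the preference scores, that for every instance $(n,k,l,\theta_1,\dots,\theta_n)$ of the problem described in the context identifies the top-$k$ items with high probability using \[ \tilde{O}\Biggl( \frac{n}{l} + k + \frac{\sum_{i \geq k+1} \theta_{i}}{\theta_k} + \sum_{i \geq k+1,\ \theta_i \geq \frac{\theta_k}{2}} \frac{\theta_{k}^2}{(\theta_k - \theta_i)^2} + \sum_{i:\, i\leq k,\ \theta_i \leq 2\theta_{k+1}} \frac{\theta_{k+1}^2}{(\theta_{k+1} - \theta_i)^2} \Biggr) \] comparisons, each of set size at most $l$ (i.e. it may use $2$-wise, $3$-wise, \dots, $l$-wise comparisons).
   Context: Top-$k$ ranking under the multinomial logit (MNL) model. There are $n$ items with positive preference scores $\theta_1 \geq \theta_2 \geq \cdots \geq \theta_k > \theta_{k+1} \geq \cdots \geq \theta_n$ (with $\theta_i=\exp(\mu_i)$ for utilities $\mu_i$); the true top-$k$ items are those with scores $\theta_1,\dots,\theta_k$. The algorithm initially sees the items only through labels assigned by a uniformly random permutation $\pi$ of $\{1,\dots,n\}$ (the item with score $\theta_i$ gets label $\pi_i$). At each round $t$ the algorithm chooses (possibly adaptively, based on all previous outcomes) a set $S_t$ of items with $2 \leq |S_t| \leq l$ and observes a single item $a\in S_t$, drawn independently of the past given $S_t$ with $\Pr[a \mid S_t] = \theta_a / \sum_{j\in S_t}\theta_j$. Each round counts as one comparison. The goal is to output the set of labels $\{\pi_1,\dots,\pi_k\}$ of the top-$k$ items. "With high probability" means with probability at least $1-1/n^{c}$ for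 a sufficiently large constant $c$. The notation $\tilde{O}(\cdot)$ hides factors polylogarithmic in $n$ and in $\frac{1}{\theta_k-\theta_{k+1}}$.
   Formalization: The hidden polylogarithmic factor is in n and in the relative inverse gap θ_k/(θ_k−θ_{k+1}) (scores normalized to θ_k=1), since with the unnormalized 1/(θ_k−θ_{k+1}) the claim fails, e.g. for n=2, k=1, scores (M+1, M), M→∞. *)

theory Defs
  imports "HOL-Probability.Probability" "HOL-Combinatorics.Permutations"
begin

text \<open>
  Items are \<open>1, \<dots>, n\<close>; \<open>\<theta> i\<close> is the preference score of item \<open>i\<close>. The values of \<open>\<theta>\<close> outside
  \<open>{1..n}\<close> are irrelevant. A query set has at most \<open>n\<close> elements anyway, so \<open>l \<le> n\<close> is not required.
\<close>

definition topk_instance :: "nat \<Rightarrow> nat \<Rightarrow> nat \<Rightarrow> (nat \<Rightarrow> real) \<Rightarrow> bool" where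
  "topk_instance n k l \<theta> \<longleftrightarrow>
     1 \<le> k \<and> k < n \<and> 2 \<le> l \<and>
     (\<forall>i\<in>{1..n}. 0 < \<theta> i) \<and>
     (\<forall>i\<in>{1..n}. \<forall>j\<in>{1..n}. i \<le> j \<longrightarrow> \<theta> j \<le> \<theta> i) \<and>
     \<theta> (k + 1) < \<theta> k"


text \<open>
  \<open>mnl_choice w S\<close> is meaningful for a finite nonempty \<open>S\<close> and weights \<open>w\<close> positive on \<open>S\<close>;
  see \<open>pmf_mnl_choice\<close> below.
\<close>

definition mnl_choice :: "(nat \<Rightarrow> real) \<Rightarrow> nat set \<Rightarrow> nat pmf" where
  "mnl_choice w S = embed_pmf (\<lambda>a. if a \<in> S then w a / (\<Sum>j\<in>S. w j) else 0)"

lemma pmf_mnl_choice: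
  assumes "finite S" "S \<noteq> {}" "\<And>a. a \<in> S \<Longrightarrow> 0 < w a"
  shows "pmf (mnl_choice w S) a = (if a \<in> S then w a / (\<Sum>j\<in>S. w j) else 0)"
proof -
  have pos: "0 < (\<Sum>j\<in>S. w j)"
    using assms by (intro sum_pos) auto
  let ?f = "\<lambda>a. if a \<in> S then w a / (\<Sum>j\<in>S. w j) else 0"
  have nonneg: "0 \<le> ?f b" for b
    using assms(3)[of b] pos by auto
  have "(\<integral>\<^sup>+b. ennreal (?f b) \<partial>count_space UNIV) = (\<Sum>b\<in>S. ennreal (?f b))"
    using assms(1) by (intro nn_integral_count_space') auto
  also have "\<dots> = ennreal (\<Sum>b\<in>S. ?f b)"
    by (rule sum_ennreal) (rule nonneg)
  also have "(\<Sum>b\<in>S. ?f b) = 1"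
    using pos by (simp flip: sum_divide_distrib)
  finally have "(\<integral>\<^sup>+b. ennreal (?f b) \<partial>count_space UNIV) = 1"
    by simp
  then show ?thesis
    unfolding mnl_choice_def by (intro pmf_embed_pmf nonneg)
qed


text \<open>
  An adaptive randomized algorithm maps the complete past to a distribution over its next move:
  a comparison of a set of labels, or halting with a set of labels. The first argument of
  \<open>Compare\<close> is private memory: it has no effect on the outcome, but it is recorded in the history,
  so that later moves may depend on earlier internal randomness.
\<close>

datatype move = Compare nat "nat set" | Output "nat set"

type_synonym history = "(nat \<times> nat set \<times> nat) list"

type_synonym algorithm = "history \<Rightarrow> move pmf"

definition valid_algorithm :: "nat \<Rightarrow> nat \<Rightarrow> algorithm \<Rightarrow> bool" where
  "valid_algorithm n l A \<longleftrightarrow>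
     (\<forall>h r S. Compare r S \<in> set_pmf (A h) \<longrightarrow> S \<subseteq> {1..n} \<and> 2 \<le> card S \<and> card S \<le> l)"

text \<open>
  \<open>run A w m h\<close> continues from history \<open>h\<close> for at most \<open>m\<close> further comparisons, where \<open>w\<close> gives
  the score behind each label. The result is \<open>Some R\<close> if the algorithm halts with output \<open>R\<close>
  within these \<open>m\<close> comparisons, and \<open>None\<close> if it asks for more. The algorithm itself is not
  told \<open>m\<close>.
\<close>

fun run :: "algorithm \<Rightarrow> (nat \<Rightarrow> real) \<Rightarrow> nat \<Rightarrow> history \<Rightarrow> nat set option pmf" where
  "run A w 0 h = bind_pmf (A h) (\<lambda>d. case d of
       Output R \<Rightarrow> return_pmf (Some R)
     | Compare r S \<Rightarrow> return_pmf None)"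
| "run A w (Suc m) h = bind_pmf (A h) (\<lambda>d. case d of
       Output R \<Rightarrow> return_pmf (Some R)
     | Compare r S \<Rightarrow> bind_pmf (mnl_choice w S) (\<lambda>a. run A w m (h @ [(r, S, a)])))"

text \<open>
  Item \<open>i\<close> gets label \<open>\<pi> i\<close>, so the score behind label \<open>a\<close> is \<open>\<theta> (inv \<pi> a)\<close>.
\<close>

definition labelled_run ::
  "algorithm \<Rightarrow> nat \<Rightarrow> (nat \<Rightarrow> real) \<Rightarrow> nat \<Rightarrow> ((nat \<Rightarrow> nat) \<times> nat set option) pmf" where
  "labelled_run A n \<theta> m =
     bind_pmf (pmf_of_set {\<pi>. \<pi> permutes {1..n}}) (\<lambda>\<pi>.
       map_pmf (\<lambda>out. (\<pi>, out)) (run A (\<theta> \<circ> inv \<pi>) m []))"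

text \<open>
  Probability, over the random labelling, the outcomes of the comparisons and the internal
  randomness of \<open>A\<close>, that \<open>A\<close> halts after at most \<open>m\<close> comparisons and outputs exactly the labels
  of the top-\<open>k\<close> items.
\<close>

definition success_prob :: "algorithm \<Rightarrow> nat \<Rightarrow> nat \<Rightarrow> (nat \<Rightarrow> real) \<Rightarrow> nat \<Rightarrow> real" where
  "success_prob A n k \<theta> m =
     measure_pmf.prob (labelled_run A n \<theta> m) {(\<pi>, out). out = Some (\<pi> ` {1..k})}"


definition complexity :: "nat \<Rightarrow> nat \<Rightarrow> nat \<Rightarrow> (nat \<Rightarrow> real) \<Rightarrow> real" where
  "complexity n k l \<theta> =
     real n / real l + real k
     + (\<Sum>i\<in>{k+1..n}. \<theta> i) / \<theta> k
     + (\<Sum>i\<in>{i\<in>{k+1..n}. \<theta> i \<ge> \<theta> k / 2}. (\<theta> k)\<^sup>2 / (\<theta> k - \<theta> i)\<^sup>2)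
     + (\<Sum>i\<in>{i\<in>{1..k}. \<theta> i \<le> 2 * \<theta> (k+1)}. (\<theta> (k+1))\<^sup>2 / (\<theta> (k+1) - \<theta> i)\<^sup>2)"

text \<open>
  The factor hidden by the soft-O notation, polylogarithmic in \<open>n\<close> and in the inverse gap. The model
  and \<open>complexity\<close> do not change when all scores are multiplied by a constant, so the gap is
  measured with the scores normalized to \<open>\<theta> k = 1\<close>, that is, as \<open>(\<theta> k - \<theta> (k+1)) / \<theta> k\<close>. Its inverse
  is greater than 1 but may be arbitrarily close to 1, hence the added constant 1.
\<close>

definition polylog_factor :: "nat \<Rightarrow> nat \<Rightarrow> nat \<Rightarrow> (nat \<Rightarrow> real) \<Rightarrow> real" where
  "polylog_factor d n k \<theta> =
     (ln (real n)) ^ d * (1 + ln (\<theta> k / (\<theta> k - \<theta> (k+1)))) ^ d"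

end

theory Submission
  imports Defs
begin

text \<open>
  Screening: in random sets of size \<open>s\<close> with \<open>n / s\<close> of the order of
  \<open>k + (\<Sum>i>k. \<theta> i) / \<theta> k\<close>, every top item wins with a constant probability whenever it is drawn,
  so about \<open>n / s\<close> such queries, up to a logarithm, leave few candidates and lose no top item. The
  right \<open>s\<close> is found by halving. The candidates are merge sorted with a noisy comparator that is
  accurate up to a factor \<open>1 + 1 / log n\<close>; the errors of the \<open>log n\<close> levels multiply to at most 3,
  so the \<open>k\<close>-th item of the result is a pivot with a score within a factor 3 of \<open>\<theta> k\<close>. Finally, in
  round \<open>r\<close> every undecided candidate is compared with the pivot until its win rate is known up to
  \<open>2 ^ - r\<close>, and is accepted or rejected as soon as the estimates separate it from the boundary. An
  item whose win rate has distance \<open>\<gamma>\<close> from the boundary survives until \<open>2 ^ - r\<close> is of the order of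
  \<open>\<gamma>\<close>, which costs about \<open>1 / \<gamma>\<^sup>2\<close> comparisons.
\<close>


section \<open>Interactive programs and their failure probability\<close>

text \<open>Win rates against one pivot \<open>p\<close> suffice because only the scale of
  \<open>p\<close> matters. If \<open>w p\<close> is within a constant factor of
  \<open>\<theta> k\<close>, a gap in \<open>w i / (w i + w p)\<close> across the boundary is at
  least 1/25 of the relative score gap, even for top items far heavier than the pivot. The inverse
  squares of these gaps sum to the last two terms of \<open>complexity\<close> plus a constant per
  candidate. That constant is why candidates must be thinned out first. An exact sort could not
  supply the pivot, since scores may be arbitrarily close; a sort up to constant factors costs only
  logarithms per candidate. The obstacle to the formalization is that the number of elimination
  rounds depends on the unknown gap, whereas every branch of a \<open>prog\<close> is finite. So the
  program carries fuel, the algorithm takes its fuel from the length of the history, and programs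
  with different fuel are shown to act alike for as long as it matters. Every single estimate fails
  with probability of order \<open>exp (- H)\<close>. A union bound gives
  \<open>9 n^2 exp (- H)\<close>, and \<open>H = (c + 6) ln n\<close> brings this below
  \<open>1 / n powr c\<close>.\<close>

datatype 'a prog = Ret 'a | Ask "nat set pmf" "nat \<Rightarrow> 'a prog"

primrec bindp :: "'a prog \<Rightarrow> ('a \<Rightarrow> 'b prog) \<Rightarrow> 'b prog" where
  "bindp (Ret x) f = f x"
| "bindp (Ask D g) f = Ask D (\<lambda>a. bindp (g a) f)"

definition answer :: "(nat \<Rightarrow> real) \<Rightarrow> nat set pmf \<Rightarrow> nat pmf" where
  "answer w D = bind_pmf D (mnl_choice w)"

text \<open>Asking beyond the budget counts as failure, so one number bounds wrong results and
  excessive cost together.\<close>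

primrec err :: "(nat \<Rightarrow> real) \<Rightarrow> ('a \<Rightarrow> bool) \<Rightarrow> 'a prog \<Rightarrow> nat \<Rightarrow> ennreal" where
  "err w Q (Ret x) = (\<lambda>m. if Q x then 0 else 1)"
| "err w Q (Ask D g) =
     (\<lambda>m. case m of 0 \<Rightarrow> 1 | Suc m' \<Rightarrow> (\<integral>\<^sup>+a. err w Q (g a) m' \<partial>measure_pmf (answer w D)))"

lemma nn_integral_pmf_le_1:
  fixes f :: "'a \<Rightarrow> ennreal"
  assumes "\<And>a. f a \<le> 1"
  shows "(\<integral>\<^sup>+a. f a \<partial>measure_pmf p) \<le> 1"
  using nn_integral_mono[of "measure_pmf p" f "\<lambda>_. 1"] assms by simp

lemma err_le_1: "err w Q p m \<le> 1"
  by (induction p arbitrary: m) (auto split: nat.split intro!: nn_integral_pmf_le_1)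

lemma err_mono_steps: "m \<le> m' \<Longrightarrow> err w Q p m' \<le> err w Q p m"
proof (induction p arbitrary: m m')
  case (Ask D g)
  then show ?case
    by (auto split: nat.split intro!: nn_integral_mono nn_integral_pmf_le_1 err_le_1)
qed simp

lemma err_mono_post: "(\<And>x. Q x \<Longrightarrow> Q' x) \<Longrightarrow> err w Q' p m \<le> err w Q p m"
  by (induction p arbitrary: m) (auto split: nat.split intro!: nn_integral_mono)

lemma err_conj: "err w (\<lambda>x. Q x \<and> Q' x) p m \<le> err w Q p m + err w Q' p m"
proof (induction p arbitrary: m)
  case (Ask D g)
  show ?case
  proof (cases m)
    case (Suc m')
    have "(\<integral>\<^sup>+a. err w (\<lambda>x. Q x \<and> Q' x) (g a) m' \<partial>answer w D)
        \<le> (\<integral>\<^sup>+a. err w Q (g a) m' + err w Q' (g a) m' \<partial>answer w D)"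
      by (intro nn_integral_mono Ask) auto
    then show ?thesis using Suc by (simp add: nn_integral_add)
  qed simp
qed auto

text \<open>Runs of \<open>p\<close> that violate \<open>Q\<close> or exceed \<open>m\<close> are
  charged in full to the first summand. A run that needs fewer than \<open>m\<close> answers leaves
  the rest to \<open>f\<close>, which does no harm by \<open>err_mono_steps\<close>.\<close>

lemma err_bind:
  assumes "\<And>x. Q x \<Longrightarrow> err w Q' (f x) m' \<le> \<delta>"
  shows "err w Q' (bindp p f) (m + m') \<le> err w Q p m + \<delta>"
proof (induction p arbitrary: m)
  case (Ret x)
  have "err w Q' (f x) (m + m') \<le> err w Q' (f x) m'" by (rule err_mono_steps) simp
  moreover have "err w Q' (f x) (m + m') \<le> 1" by (rule err_le_1)
  ultimately show ?case using assms[of x] by (auto intro: order_trans add_increasing2)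
next
  case (Ask D g)
  show ?case
  proof (cases m)
    case 0
    then show ?thesis using err_le_1 by (metis add_increasing2 err.simps(2) nat.simps(4) zero_le)
  next
    case (Suc k)
    have "(\<integral>\<^sup>+a. err w Q' (bindp (g a) f) (k + m') \<partial>answer w D)
        \<le> (\<integral>\<^sup>+a. err w Q (g a) k + \<delta> \<partial>answer w D)"
      by (intro nn_integral_mono Ask) auto
    then show ?thesis using Suc by (simp add: nn_integral_add)
  qed
qed

lemma err_bind_Ret: "err w Q (bindp p (\<lambda>x. Ret (h x))) m = err w (\<lambda>x. Q (h x)) p m"
  by (induction p arbitrary: m) (auto split: nat.split)

text \<open>A Hoare triple with a budget and a failure probability. Nonnegativity of \<delta> is
  part of it because \<open>ennreal\<close> maps negative numbers to 0, which would break the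
  addition of failure probabilities.\<close>

definition ok :: "(nat \<Rightarrow> real) \<Rightarrow> nat \<Rightarrow> real \<Rightarrow> 'a prog \<Rightarrow> ('a \<Rightarrow> bool) \<Rightarrow> bool" where
  "ok w m \<delta> p Q \<longleftrightarrow> 0 \<le> \<delta> \<and> err w Q p m \<le> ennreal \<delta>"

lemma ok_Ret: "Q x \<Longrightarrow> 0 \<le> \<delta> \<Longrightarrow> ok w m \<delta> (Ret x) Q"
  by (simp add: ok_def)

lemma ok_mono:
  assumes "ok w m \<delta> p Q" "m \<le> m'" "\<delta> \<le> \<delta>'" "\<And>x. Q x \<Longrightarrow> Q' x"
  shows "ok w m' \<delta>' p Q'"
proof -
  have "err w Q' p m' \<le> err w Q' p m" by (rule err_mono_steps) fact
  also have "\<dots> \<le> err w Q p m" by (rule err_mono_post) fact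
  also have "\<dots> \<le> ennreal \<delta>" using assms by (simp add: ok_def)
  also have "\<dots> \<le> ennreal \<delta>'" using assms by (intro ennreal_leI)
  finally show ?thesis using assms by (auto simp: ok_def)
qed

lemma ok_conj:
  assumes "ok w m \<delta> p Q" "ok w m \<delta>' p Q'"
  shows "ok w m (\<delta> + \<delta>') p (\<lambda>x. Q x \<and> Q' x)"
  using assms err_conj[of w Q Q' p m] unfolding ok_def
  by (auto simp: ennreal_plus intro: order_trans add_mono)

lemma ok_ball:
  assumes "finite I" "I \<noteq> {}" "\<And>i. i \<in> I \<Longrightarrow> ok w m \<delta> p (Q i)"
  shows "ok w m (real (card I) * \<delta>) p (\<lambda>x. \<forall>i\<in>I. Q i x)"
  using assms
proof (induction I rule: finite_ne_induct)
  case (insert i I)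
  have "ok w m (\<delta> + real (card I) * \<delta>) p (\<lambda>x. Q i x \<and> (\<forall>i\<in>I. Q i x))"
    using insert by (intro ok_conj) auto
  then show ?case using insert by (auto simp: algebra_simps elim!: ok_mono)
qed (auto elim!: ok_mono)

text \<open>The condition on \<open>\<delta>'\<close> is stated separately because the second
  premise yields nothing when no value satisfies \<open>Q\<close>.\<close>

lemma ok_bind:
  assumes "ok w m \<delta> p Q" "\<And>x. Q x \<Longrightarrow> ok w m' \<delta>' (f x) Q'" "0 \<le> \<delta>'"
  shows "ok w (m + m') (\<delta> + \<delta>') (bindp p f) Q'"
proof -
  have "err w Q' (bindp p f) (m + m') \<le> err w Q p m + ennreal \<delta>'"
    using assms by (intro err_bind) (auto simp: ok_def)
  also have "\<dots> \<le> ennreal \<delta> + ennreal \<delta>'"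
    using assms by (intro add_mono) (auto simp: ok_def)
  finally show ?thesis using assms by (simp add: ok_def ennreal_plus)
qed

lemma ok_bind_Ret:
  "ok w m \<delta> (bindp p (\<lambda>x. Ret (h x))) Q \<longleftrightarrow> ok w m \<delta> p (\<lambda>x. Q (h x))"
  by (simp add: ok_def err_bind_Ret)

lemma ok_Ask:
  assumes "\<And>a. ok w m \<delta> (g a) Q"
  shows "ok w (Suc m) \<delta> (Ask D g) Q"
proof -
  have "(\<integral>\<^sup>+a. err w Q (g a) m \<partial>answer w D) \<le> (\<integral>\<^sup>+a. ennreal \<delta> \<partial>answer w D)"
    using assms by (intro nn_integral_mono) (auto simp: ok_def)
  then show ?thesis using assms by (auto simp: ok_def)
qed

section \<open>From programs to algorithms\<close>

primrec validp :: "nat \<Rightarrow> nat \<Rightarrow> 'a prog \<Rightarrow> bool" where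
  "validp n l (Ret x) \<longleftrightarrow> True"
| "validp n l (Ask D g) \<longleftrightarrow>
     (\<forall>S\<in>set_pmf D. S \<subseteq> {1..n} \<and> 2 \<le> card S \<and> card S \<le> l) \<and> (\<forall>a. validp n l (g a))"

lemma validp_bind:
  "validp n l p \<Longrightarrow> (\<And>x. validp n l (f x)) \<Longrightarrow> validp n l (bindp p f)"
  by (induction p) auto

text \<open>The continuation of \<open>Ask\<close> sees the winner but not the set that was drawn.
  The list of past winners therefore determines the state of a program, and the private memory of
  its moves can stay 0.\<close>

fun follow :: "'a prog \<Rightarrow> nat list \<Rightarrow> 'a prog" where
  "follow (Ask D g) (a # as) = follow (g a) as"
| "follow p as = p"

lemma follow_Ret [simp]: "follow (Ret x) as = Ret x"
  by (cases as) auto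

lemma follow_snoc:
  "follow p (as @ [a]) = follow (follow p as) [a]"
  by (induction p as rule: follow.induct) auto

lemma validp_follow: "validp n l p \<Longrightarrow> validp n l (follow p as)"
  by (induction p as rule: follow.induct) auto

fun act :: "nat set prog \<Rightarrow> move pmf" where
  "act (Ret R) = return_pmf (Output R)"
| "act (Ask D g) = map_pmf (Compare 0) D"

definition answers :: "history \<Rightarrow> nat list" where
  "answers = map (\<lambda>(r, S, a). a)"

text \<open>The hypothesis is limited to histories that a run with \<open>m\<close> further
  comparisons can reach, because the final algorithm follows a fixed program only up to a given
  length. At budget 0, a further query yields \<open>None\<close> on the one side and
  \<open>err\<close> 1 on the other.\<close>

lemma err_run:
  assumes "\<And>h'. length h' \<le> length h + m \<Longrightarrow> A h' = act (follow p (answers h'))"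
  shows "emeasure (measure_pmf (run A w m h)) {x. \<not> (\<exists>R. x = Some R \<and> Q R)}
    = err w Q (follow p (answers h)) m"
  using assms
proof (induction m arbitrary: h)
  case 0
  then have A: "A h = act (follow p (answers h))" by simp
  show ?case
  proof (cases "follow p (answers h)")
    case (Ret R)
    then show ?thesis using A by (simp add: bind_return_pmf)
  next
    case (Ask D g)
    then show ?thesis using A by (simp add: bind_map_pmf bind_return_pmf)
  qed
next
  case (Suc m)
  then have A: "A h = act (follow p (answers h))" by simp
  show ?case
  proof (cases "follow p (answers h)")
    case (Ret R)
    then show ?thesis using A by (simp add: bind_return_pmf)
  next
    case (Ask D g)
    have IH: "emeasure (measure_pmf (run A w m (h @ [(0, S, a)]))) {x. \<not> (\<exists>R. x = Some R \<and> Q R)}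
        = err w Q (g a) m" for S a
      using Suc.IH[of "h @ [(0, S, a)]"] Suc.prems Ask
      by (simp add: answers_def follow_snoc)
    show ?thesis using A Ask IH
      by (simp add: bind_map_pmf answer_def)
  qed
qed

text \<open>Equality of programs as far as \<open>t\<close> answers can tell. It lets a family of
  programs with growing fuel play the part of a single program of unbounded depth.\<close>

fun agree :: "nat \<Rightarrow> 'a prog \<Rightarrow> 'a prog \<Rightarrow> bool" where
  "agree t (Ret x) (Ret y) \<longleftrightarrow> x = y"
| "agree 0 (Ask D g) (Ask D' g') \<longleftrightarrow> D = D'"
| "agree (Suc t) (Ask D g) (Ask D' g') \<longleftrightarrow> D = D' \<and> (\<forall>a. agree t (g a) (g' a))"
| "agree t _ _ \<longleftrightarrow> False"

lemma agree_Suc_imp: "agree (Suc t) p q \<Longrightarrow> agree t p q"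
proof (induction "Suc t" p q arbitrary: t rule: agree.induct)
  case (3 t D g D' g')
  then show ?case by (cases t) auto
qed auto

lemma agree_bind: "(\<And>x. agree t (f x) (f' x)) \<Longrightarrow> agree t (bindp p f) (bindp p f')"
proof (induction p arbitrary: t)
  case (Ask D g)
  show ?case
  proof (cases t)
    case (Suc k)
    have "agree k (bindp (g a) f) (bindp (g a) f')" for a
      by (rule Ask.IH) (use Ask.prems Suc agree_Suc_imp in auto)
    then show ?thesis using Suc by simp
  qed auto
qed auto

lemma agree_follow: "agree t p q \<Longrightarrow> length as \<le> t \<Longrightarrow> act (follow p as) = act (follow q as)"
proof (induction t p q arbitrary: as rule: agree.induct)
  case (3 t D g D' g')
  then show ?case by (cases as) auto
qed auto


section \<open>Concentration of sampled win counts\<close>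

primrec sample :: "nat set pmf \<Rightarrow> nat \<Rightarrow> nat list prog" where
  "sample D 0 = Ret []"
| "sample D (Suc N) = Ask D (\<lambda>a. bindp (sample D N) (\<lambda>as. Ret (a # as)))"

lemma validp_sample:
  assumes "\<And>S. S \<in> set_pmf D \<Longrightarrow> S \<subseteq> {1..n} \<and> 2 \<le> card S \<and> card S \<le> l"
  shows "validp n l (sample D N)"
proof (induction N)
  case (Suc N)
  then show ?case using assms by (simp add: validp_bind)
qed simp

lemma nn_integral_two_valued:
  fixes p :: "'a pmf"
  assumes "0 \<le> x" "0 \<le> y"
  shows "(\<integral>\<^sup>+a. ennreal (if a = i then x else y) \<partial>measure_pmf p)
    = ennreal (x * pmf p i + y * (1 - pmf p i))"
proof -
  have "(\<integral>\<^sup>+a. ennreal (if a = i then x else y) \<partial>measure_pmf p)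
     = (\<integral>\<^sup>+a. ennreal x * indicator {i} a + ennreal y * indicator (- {i}) a \<partial>measure_pmf p)"
    by (intro nn_integral_cong) (auto simp: indicator_def)
  also have "\<dots> = ennreal x * emeasure p {i} + ennreal y * emeasure p (- {i})"
    by (simp add: nn_integral_add nn_integral_cmult)
  also have "emeasure p {i} = ennreal (pmf p i)"
    by (simp add: emeasure_pmf_single)
  also have "emeasure p (- {i}) = ennreal (1 - pmf p i)"
    using measure_pmf.prob_compl[of "{i}" p]
    by (simp add: measure_pmf.emeasure_eq_measure measure_pmf_single Compl_eq_Diff_UNIV)
  finally show ?thesis
    using assms by (simp add: ennreal_mult ennreal_plus pmf_le_1)
qed

text \<open>
  The Chernoff method: \<open>(x, y)\<close> is the exponential weight of a hit and of a miss.
\<close>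

lemma ok_sample:
  assumes xy: "0 \<le> x" "0 \<le> y"
    and \<rho>: "x * pmf (answer w D) i + y * (1 - pmf (answer w D) i) \<le> \<rho>"
    and bad: "\<And>as. length as = N \<Longrightarrow> \<not> Q as \<Longrightarrow>
       1 \<le> x ^ count_list as i * y ^ (N - count_list as i)"
  shows "ok w N (\<rho> ^ N) (sample D N) Q"
proof -
  let ?q = "pmf (answer w D) i"
  have \<rho>0: "0 \<le> \<rho>"
    using xy \<rho> pmf_le_1[of "answer w D" i]
    by (meson add_nonneg_nonneg diff_ge_0_iff_ge mult_nonneg_nonneg order_trans pmf_nonneg)
  \<comment> \<open>Markov's inequality by induction: \<open>c\<close> is the weight collected by
    the winners already drawn, and \<open>Q\<close> is the condition that they leave for the rest of
    the list.\<close>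
  have "err w Q (sample D N) N \<le> ennreal (c * \<rho> ^ N)"
    if "0 \<le> c" "\<And>as. length as = N \<Longrightarrow> \<not> Q as \<Longrightarrow>
       1 \<le> c * (x ^ count_list as i * y ^ (N - count_list as i))" for c Q
    using that
  proof (induction N arbitrary: c Q)
    case 0
    then show ?case by (auto simp: ennreal_ge_1)
  next
    case (Suc N)
    have "err w (\<lambda>as. Q (a # as)) (sample D N) N
        \<le> ennreal ((c * (if a = i then x else y)) * \<rho> ^ N)" for a
    proof (rule Suc.IH)
      show "0 \<le> c * (if a = i then x else y)" using Suc.prems xy by auto
      fix as :: "nat list" assume "length as = N" "\<not> Q (a # as)"
      then have "1 \<le> c * (x ^ count_list (a # as) i * y ^ (Suc N - count_list (a # as) i))"
        by (intro Suc.prems) auto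
      moreover have "count_list as i \<le> N"
        using \<open>length as = N\<close> count_le_length by metis
      ultimately show "1 \<le> c * (if a = i then x else y) *
          (x ^ count_list as i * y ^ (N - count_list as i))"
        by (auto simp: Suc_diff_le algebra_simps)
    qed
    then have "err w Q (sample D (Suc N)) (Suc N)
        \<le> (\<integral>\<^sup>+a. ennreal ((c * \<rho> ^ N) * (if a = i then x else y)) \<partial>answer w D)"
      by (auto simp: err_bind_Ret mult_ac intro!: nn_integral_mono)
    also have "\<dots> = ennreal (c * \<rho> ^ N) * (\<integral>\<^sup>+a. ennreal (if a = i then x else y) \<partial>answer w D)"
      using Suc.prems \<rho>0 xy
      by (subst nn_integral_cmult[symmetric]) (auto intro!: nn_integral_cong simp: ennreal_mult)
    also have "\<dots> = ennreal (c * \<rho> ^ N) * ennreal (x * ?q + y * (1 - ?q))"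
      using xy by (simp add: nn_integral_two_valued)
    also have "\<dots> \<le> ennreal (c * \<rho> ^ N) * ennreal \<rho>"
      using \<rho> by (intro mult_left_mono ennreal_leI) auto
    also have "\<dots> = ennreal (c * \<rho> ^ Suc N)"
      using Suc.prems \<rho>0 by (simp add: ennreal_mult mult_ac)
    finally show ?case .
  qed
  from this[of 1 Q] show ?thesis using bad \<rho>0 by (auto simp: ok_def)
qed

lemma exp_le_quadratic:
  fixes x :: real assumes "\<bar>x\<bar> \<le> 1" shows "exp x \<le> 1 + x + x\<^sup>2"
proof (cases "0 \<le> x")
  case True then show ?thesis using exp_bound assms by auto
next
  case False
  define y where "y = - x"
  have y: "0 < y" "y \<le> 1" using False assms by (auto simp: y_def)
  have "1 \<le> (1 - y + y\<^sup>2) * (1 + y)"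
    using y by (simp add: algebra_simps power2_eq_square)
  also have "\<dots> \<le> (1 - y + y\<^sup>2) * exp y"
    using y exp_ge_add_one_self[of y]
    by (intro mult_left_mono) (auto simp: power2_eq_square)
  finally have "1 \<le> (1 - y + y\<^sup>2) * exp y" .
  then have "exp (- y) * 1 \<le> exp (-y) * ((1 - y + y\<^sup>2) * exp y)"
    by (intro mult_left_mono) auto
  also have "\<dots> = 1 - y + y\<^sup>2" by (simp add: exp_minus field_simps)
  finally show ?thesis by (simp add: y_def)
qed

text \<open>With these weights a list has total weight
  \<open>exp (\<kappa> * (count - t * N))\<close>, so the sign of \<kappa> selects the tail. The
  exponent keeps its factor \<open>q\<close>: this gives multiplicative bounds, needed in the
  screening where \<open>q\<close> is tiny, as well as additive ones.\<close>

lemma ok_sample_exp: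
  fixes w D i N and \<kappa> t :: real
  defines "q \<equiv> pmf (answer w D) i"
  assumes \<kappa>: "\<bar>\<kappa>\<bar> \<le> 1"
    and bad: "\<And>as. length as = N \<Longrightarrow> \<not> Q as \<Longrightarrow> 0 \<le> \<kappa> * (real (count_list as i) - t * real N)"
  shows "ok w N (exp (real N * (q * (\<kappa> + \<kappa>\<^sup>2) - \<kappa> * t))) (sample D N) Q"
proof -
  have "ok w N (exp (q * (\<kappa> + \<kappa>\<^sup>2) - \<kappa> * t) ^ N) (sample D N) Q"
  proof (rule ok_sample[of "exp (\<kappa> * (1 - t))" "exp (- \<kappa> * t)" _ _ i])
    have "exp (\<kappa> * (1 - t)) * q + exp (- \<kappa> * t) * (1 - q) = exp (- \<kappa> * t) * (1 + q * (exp \<kappa> - 1))"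
      by (simp add: algebra_simps flip: exp_add)
    also have "\<dots> \<le> exp (- \<kappa> * t) * exp (q * (\<kappa> + \<kappa>\<^sup>2))"
    proof (intro mult_left_mono)
      have "1 + q * (exp \<kappa> - 1) \<le> 1 + q * (\<kappa> + \<kappa>\<^sup>2)"
        using exp_le_quadratic[OF \<kappa>] by (auto simp: q_def intro!: mult_left_mono)
      also have "\<dots> \<le> exp (q * (\<kappa> + \<kappa>\<^sup>2))" by (rule exp_ge_add_one_self)
      finally show "1 + q * (exp \<kappa> - 1) \<le> exp (q * (\<kappa> + \<kappa>\<^sup>2))" .
    qed auto
    also have "\<dots> = exp (q * (\<kappa> + \<kappa>\<^sup>2) - \<kappa> * t)" by (simp flip: exp_add)
    finally show "exp (\<kappa> * (1 - t)) * pmf (answer w D) i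
        + exp (- \<kappa> * t) * (1 - pmf (answer w D) i) \<le> exp (q * (\<kappa> + \<kappa>\<^sup>2) - \<kappa> * t)"
      by (simp add: q_def)
  next
    fix as :: "nat list" assume as: "length as = N" "\<not> Q as"
    have le: "count_list as i \<le> N" using as count_le_length by metis
    have "exp (\<kappa> * (1 - t)) ^ count_list as i * exp (- \<kappa> * t) ^ (N - count_list as i)
       = exp (\<kappa> * (real (count_list as i) - t * real N))"
      using le by (simp add: of_nat_diff algebra_simps flip: exp_of_nat_mult exp_add)
    then show "1 \<le> exp (\<kappa> * (1 - t)) ^ count_list as i * exp (- \<kappa> * t) ^ (N - count_list as i)"
      using bad[OF as] by simp
  qed auto
  then show ?thesis by (simp add: exp_of_nat_mult)
qed

text \<open>Since \<open>q \<le> 1\<close>, the exponent is at most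
  \<open>\<kappa>^2 - \<kappa> * \<epsilon>\<close> per sample, and
  \<open>\<kappa> = \<epsilon> / 2\<close> minimizes this.\<close>

lemma ok_sample_upper:
  assumes "pmf (answer w D) i + \<epsilon> \<le> t" "0 \<le> \<epsilon>" "\<epsilon> \<le> 1"
  shows "ok w N (exp (- real N * \<epsilon>\<^sup>2 / 4)) (sample D N) (\<lambda>as. real (count_list as i) < t * real N)"
proof -
  let ?q = "pmf (answer w D) i"
  have "ok w N (exp (real N * (?q * (\<epsilon>/2 + (\<epsilon>/2)\<^sup>2) - \<epsilon>/2 * t)))
     (sample D N) (\<lambda>as. real (count_list as i) < t * real N)"
    using assms by (intro ok_sample_exp) auto
  moreover have "real N * (?q * (\<epsilon>/2 + (\<epsilon>/2)\<^sup>2) - \<epsilon>/2 * t) \<le> real N * (- \<epsilon>\<^sup>2 / 4)"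
  proof (intro mult_left_mono)
    have "\<epsilon>/2 * (?q + \<epsilon>) \<le> \<epsilon>/2 * t" using assms by (intro mult_left_mono) auto
    moreover have "?q * (\<epsilon>/2)\<^sup>2 \<le> 1 * (\<epsilon>/2)\<^sup>2" by (intro mult_right_mono pmf_le_1) auto
    ultimately show "?q * (\<epsilon>/2 + (\<epsilon>/2)\<^sup>2) - \<epsilon>/2 * t \<le> - \<epsilon>\<^sup>2 / 4"
      by (simp add: algebra_simps power2_eq_square)
  qed auto
  ultimately show ?thesis by (auto elim!: ok_mono)
qed

lemma ok_sample_lower:
  assumes "t + \<epsilon> \<le> pmf (answer w D) i" "0 \<le> \<epsilon>" "\<epsilon> \<le> 1"
  shows "ok w N (exp (- real N * \<epsilon>\<^sup>2 / 4)) (sample D N) (\<lambda>as. t * real N < real (count_list as i))"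
proof -
  let ?q = "pmf (answer w D) i"
  have "ok w N (exp (real N * (?q * (-\<epsilon>/2 + (-\<epsilon>/2)\<^sup>2) - (-\<epsilon>/2) * t)))
     (sample D N) (\<lambda>as. t * real N < real (count_list as i))"
  proof (rule ok_sample_exp)
    fix as :: "nat list" assume "\<not> t * real N < real (count_list as i)"
    then show "0 \<le> - \<epsilon>/2 * (real (count_list as i) - t * real N)"
      using assms by (intro mult_nonpos_nonpos) auto
  qed (use assms in auto)
  moreover have "real N * (?q * (-\<epsilon>/2 + (-\<epsilon>/2)\<^sup>2) - (-\<epsilon>/2) * t) \<le> real N * (- \<epsilon>\<^sup>2 / 4)"
  proof (intro mult_left_mono)
    have "\<epsilon>/2 * (t + \<epsilon>) \<le> \<epsilon>/2 * ?q" using assms by (intro mult_left_mono) auto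
    moreover have "?q * (\<epsilon>/2)\<^sup>2 \<le> 1 * (\<epsilon>/2)\<^sup>2" by (intro mult_right_mono pmf_le_1) auto
    ultimately show "?q * (-\<epsilon>/2 + (-\<epsilon>/2)\<^sup>2) - (-\<epsilon>/2) * t \<le> - \<epsilon>\<^sup>2 / 4"
      by (simp add: algebra_simps power2_eq_square)
  qed auto
  ultimately show ?thesis by (auto elim!: ok_mono)
qed

section \<open>Estimating pairwise win rates\<close>

text \<open>
  The guard keeps the query legal for arbitrary \<open>x\<close> and \<open>y\<close>; for \<open>x = y\<close> the value \<open>1 / 2\<close> is exact.
\<close>

definition estimate :: "nat \<Rightarrow> nat \<Rightarrow> nat \<Rightarrow> nat \<Rightarrow> real prog" where
  "estimate n N x y = (if x \<in> {1..n} \<and> y \<in> {1..n} \<and> x \<noteq> y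
     then bindp (sample (return_pmf {x, y}) N) (\<lambda>as. Ret (real (count_list as x) / real N))
     else Ret (1 / 2))"

lemma validp_estimate: "2 \<le> l \<Longrightarrow> validp n l (estimate n N x y)"
  by (auto simp: estimate_def intro!: validp_bind validp_sample)

lemma pmf_answer_pair:
  assumes "0 < w x" "0 < w y" "x \<noteq> y"
  shows "pmf (answer w (return_pmf {x, y})) x = w x / (w x + w y)"
proof -
  have "pmf (mnl_choice w {x, y}) x = w x / (\<Sum>j\<in>{x, y}. w j)"
    using assms by (subst pmf_mnl_choice) auto
  then show ?thesis using assms by (simp add: answer_def bind_return_pmf)
qed

lemma ok_estimate:
  assumes pos: "\<And>i. i \<in> {1..n} \<Longrightarrow> 0 < w i" and "x \<in> {1..n}" "y \<in> {1..n}" "0 < N"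
    and "0 \<le> \<epsilon>" "\<epsilon> \<le> 1"
  shows "ok w N (2 * exp (- real N * \<epsilon>\<^sup>2 / 4)) (estimate n N x y)
     (\<lambda>e. \<bar>e - w x / (w x + w y)\<bar> \<le> \<epsilon>)"
proof (cases "x = y")
  case True
  have "w x / (w x + w x) = 1 / 2" using pos[OF assms(2)] by (simp add: field_simps)
  then show ?thesis using True assms by (auto simp: estimate_def intro!: ok_Ret)
next
  case False
  let ?q = "w x / (w x + w y)" and ?D = "return_pmf {x, y}"
  have q: "pmf (answer w ?D) x = ?q"
    using pos assms False by (intro pmf_answer_pair) auto
  have "ok w N (exp (- real N * \<epsilon>\<^sup>2 / 4) + exp (- real N * \<epsilon>\<^sup>2 / 4)) (sample ?D N)
     (\<lambda>as. real (count_list as x) < (?q + \<epsilon>) * real N \<and> (?q - \<epsilon>) * real N < real (count_list as x))"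
    using assms q by (intro ok_conj ok_sample_upper ok_sample_lower) auto
  then have "ok w N (2 * exp (- real N * \<epsilon>\<^sup>2 / 4)) (sample ?D N)
     (\<lambda>as. \<bar>real (count_list as x) / real N - ?q\<bar> \<le> \<epsilon>)"
  proof (rule ok_mono)
    fix as assume "real (count_list as x) < (?q + \<epsilon>) * real N \<and> (?q - \<epsilon>) * real N < real (count_list as x)"
    then have "real (count_list as x) / real N < ?q + \<epsilon>" "?q - \<epsilon> < real (count_list as x) / real N"
      using \<open>0 < N\<close> by (simp_all only: pos_divide_less_eq pos_less_divide_eq of_nat_0_less_iff)
    then show "\<bar>real (count_list as x) / real N - ?q\<bar> \<le> \<epsilon>" by linarith
  qed auto
  then show ?thesis using False assms by (simp add: estimate_def ok_bind_Ret)
qed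

primrec estimates :: "nat \<Rightarrow> nat \<Rightarrow> nat \<Rightarrow> nat list \<Rightarrow> (nat \<Rightarrow> real) prog" where
  "estimates n N p [] = Ret (\<lambda>_. 0)"
| "estimates n N p (x # xs) =
     bindp (estimate n N x p) (\<lambda>e. bindp (estimates n N p xs) (\<lambda>f. Ret (f(x := e))))"

lemma validp_estimates: "2 \<le> l \<Longrightarrow> validp n l (estimates n N p xs)"
  by (induction xs) (auto intro!: validp_bind validp_estimate)

lemma ok_estimates:
  assumes pos: "\<And>i. i \<in> {1..n} \<Longrightarrow> 0 < w i" and "p \<in> {1..n}" "0 < N" "0 \<le> \<epsilon>" "\<epsilon> \<le> 1"
    and "set xs \<subseteq> {1..n}"
  shows "ok w (length xs * N) (length xs * (2 * exp (- real N * \<epsilon>\<^sup>2 / 4))) (estimates n N p xs)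
     (\<lambda>f. \<forall>x\<in>set xs. \<bar>f x - w x / (w x + w p)\<bar> \<le> \<epsilon>)"
  using \<open>set xs \<subseteq> {1..n}\<close>
proof (induction xs)
  case (Cons x xs)
  let ?\<delta> = "2 * exp (- real N * \<epsilon>\<^sup>2 / 4)"
  have "ok w (N + length xs * N) (?\<delta> + length xs * ?\<delta>) (estimates n N p (x # xs))
     (\<lambda>f. \<forall>x\<in>set (x # xs). \<bar>f x - w x / (w x + w p)\<bar> \<le> \<epsilon>)"
    unfolding estimates.simps
  proof (rule ok_bind)
    show "ok w N ?\<delta> (estimate n N x p) (\<lambda>e. \<bar>e - w x / (w x + w p)\<bar> \<le> \<epsilon>)"
      using assms Cons.prems by (intro ok_estimate) auto
    fix e :: real assume "\<bar>e - w x / (w x + w p)\<bar> \<le> \<epsilon>"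
    then show "ok w (length xs * N) (length xs * ?\<delta>)
       (bindp (estimates n N p xs) (\<lambda>f. Ret (f(x := e))))
       (\<lambda>f. \<forall>x\<in>set (x # xs). \<bar>f x - w x / (w x + w p)\<bar> \<le> \<epsilon>)"
      using Cons by (auto simp: ok_bind_Ret elim!: ok_mono)
  qed auto
  then show ?case by (auto simp: algebra_simps elim!: ok_mono)
qed (auto intro: ok_Ret)


section \<open>Win probabilities in random sets\<close>

definition subset_family :: "nat \<Rightarrow> nat \<Rightarrow> nat set set" where
  "subset_family n s = {S. S \<subseteq> {1..n} \<and> card S = s}"

lemma finite_subset_family [simp]: "finite (subset_family n s)"
  by (auto simp: subset_family_def)

lemma card_subset_family: "card (subset_family n s) = n choose s"
  using n_subsets[of "{1..n}" s] by (simp add: subset_family_def)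

lemma subset_family_nonempty: "s \<le> n \<Longrightarrow> subset_family n s \<noteq> {}"
  using card_subset_family[of n s] by (metis card.empty binomial_eq_0_iff not_less)

lemma finite_subset_familyD: "S \<in> subset_family n s \<Longrightarrow> finite S"
  unfolding subset_family_def using finite_subset by blast

lemma card_subsets_above:
  assumes "finite A" "B \<subseteq> A" "card B \<le> s"
  shows "card {S. S \<subseteq> A \<and> card S = s \<and> B \<subseteq> S} = (card A - card B) choose (s - card B)"
proof -
  have fB: "finite B" using assms finite_subset by blast
  have "bij_betw (\<lambda>S. S \<union> B) {S. S \<subseteq> A - B \<and> card S = s - card B}
      {S. S \<subseteq> A \<and> card S = s \<and> B \<subseteq> S}"
  proof (rule bij_betw_byWitness[where f' = "\<lambda>S. S - B"])
    show "(\<lambda>S. S \<union> B) ` {S. S \<subseteq> A - B \<and> card S = s - card B}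
        \<subseteq> {S. S \<subseteq> A \<and> card S = s \<and> B \<subseteq> S}"
    proof safe
      fix S assume S: "S \<subseteq> A - B" "card S = s - card B"
      have "finite S" using S assms finite_subset by blast
      then show "card (S \<union> B) = s"
        using S fB assms by (subst card_Un_disjoint) auto
    qed (use assms in auto)
    show "(\<lambda>S. S - B) ` {S. S \<subseteq> A \<and> card S = s \<and> B \<subseteq> S}
        \<subseteq> {S. S \<subseteq> A - B \<and> card S = s - card B}"
      using fB by (auto simp: card_Diff_subset)
  qed auto
  then have "card {S. S \<subseteq> A \<and> card S = s \<and> B \<subseteq> S} = card {S. S \<subseteq> A - B \<and> card S = s - card B}"
    by (simp add: bij_betw_same_card)
  also have "\<dots> = card (A - B) choose (s - card B)"
    using assms by (intro n_subsets) auto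
  finally show ?thesis using assms fB by (simp add: card_Diff_subset)
qed

definition win_prob :: "(nat \<Rightarrow> real) \<Rightarrow> nat \<Rightarrow> nat \<Rightarrow> nat \<Rightarrow> real" where
  "win_prob w n s i = pmf (answer w (pmf_of_set (subset_family n s))) i"

lemma win_prob_eq:
  assumes "\<And>i. i \<in> {1..n} \<Longrightarrow> 0 < w i" "1 \<le> s" "s \<le> n"
  shows "win_prob w n s i
    = (\<Sum>S\<in>subset_family n s. if i \<in> S then w i / sum w S else 0) / card (subset_family n s)"
proof -
  have "pmf (mnl_choice w S) i = (if i \<in> S then w i / sum w S else 0)"
    if "S \<in> subset_family n s" for S
    using that assms finite_subset_familyD[OF that]
    by (subst pmf_mnl_choice) (auto simp: subset_family_def)
  then show ?thesis
    using assms subset_family_nonempty[of s n]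
    by (simp add: win_prob_def answer_def pmf_bind_pmf_of_set)
qed

text \<open>
  Swapping \<open>i\<close> and \<open>j\<close> maps the sets containing \<open>i\<close> to the sets containing \<open>j\<close>, and the
  competitors of \<open>j\<close> in the image are at least as heavy as those of \<open>i\<close> in the original.
\<close>

lemma win_prob_mono:
  assumes pos: "\<And>i. i \<in> {1..n} \<Longrightarrow> 0 < w i" and s: "1 \<le> s" "s \<le> n"
    and ij: "i \<in> {1..n}" "j \<in> {1..n}" and le: "w j \<le> w i"
  shows "win_prob w n s j \<le> win_prob w n s i"
proof -
  let ?F = "subset_family n s" and ?\<tau> = "Transposition.transpose i j"
  let ?f = "\<lambda>i S. if i \<in> S then w i / sum w S else 0"
  have img: "?\<tau> ` S \<in> ?F" if "S \<in> ?F" for S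
  proof -
    have "?\<tau> ` S \<subseteq> {1..n}" using that ij by (auto simp: subset_family_def Transposition.transpose_def)
    then show ?thesis using that by (simp add: subset_family_def card_image)
  qed
  have "bij_betw ((`) ?\<tau>) ?F ?F"
    by (rule bij_betw_byWitness[where f' = "(`) ?\<tau>"]) (auto simp: image_comp intro: img)
  then have "(\<Sum>S\<in>?F. ?f j S) = (\<Sum>S\<in>?F. ?f j (?\<tau> ` S))"
    by (rule sum.reindex_bij_betw[symmetric])
  also have "\<dots> \<le> (\<Sum>S\<in>?F. ?f i S)"
  proof (rule sum_mono)
    fix S assume S: "S \<in> ?F"
    have fin: "finite S" and sub: "S \<subseteq> {1..n}"
      using S finite_subset_familyD[OF S] by (simp_all add: subset_family_def)
    have mem: "j \<in> ?\<tau> ` S \<longleftrightarrow> i \<in> S"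
      by (metis inj_image_mem_iff inj_transpose transpose_apply_first)
    show "?f j (?\<tau> ` S) \<le> ?f i S"
    proof (cases "i \<in> S")
      case True
      define R where "R = sum w (S - {i})"
      define R' where "R' = (\<Sum>x\<in>S - {i}. w (?\<tau> x))"
      have "sum w (?\<tau> ` S) = (\<Sum>x\<in>S. w (?\<tau> x))" by (subst sum.reindex) auto
      also have "\<dots> = w j + R'" using True fin by (simp add: R'_def sum.remove)
      finally have e1: "sum w (?\<tau> ` S) = w j + R'" .
      have e2: "sum w S = w i + R" using True fin by (simp add: R_def sum.remove)
      have RR: "R \<le> R'" unfolding R_def R'_def
        using le by (intro sum_mono) (auto simp: Transposition.transpose_def)
      have R0: "0 \<le> R" unfolding R_def using sub by (intro sum_nonneg less_imp_le pos) blast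
      have "w j / (w j + R') \<le> w j / (w j + R)"
        using RR R0 pos[OF ij(2)] by (intro divide_left_mono) auto
      also have "\<dots> \<le> w i / (w i + R)"
      proof -
        have "w j * (w i + R) \<le> w i * (w j + R)"
          using mult_right_mono[OF le R0] by (simp add: algebra_simps)
        then show ?thesis
          using R0 pos[OF ij(2)] pos[OF ij(1)] by (simp add: frac_le_eq divide_nonpos_pos)
      qed
      finally show ?thesis using True mem e1 e2 by simp
    qed (use mem in auto)
  qed
  finally show ?thesis
    unfolding win_prob_eq[of n w s, OF pos s, simplified] by (intro divide_right_mono) auto
qed

text \<open>For a fixed set containing \<open>i\<close>, the chance of \<open>i\<close> is at least
  1 minus the sum of \<open>min 1 (w j / w i)\<close> over its competitors: if none is heavier this
  is \<open>1 / (1 + x) \<ge> 1 - x\<close>, and one heavier competitor already makes the right side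
  nonpositive. Averaging uses that \<open>i\<close> is drawn with probability \<open>s / n\<close>,
  and then \<open>j\<close> with conditional probability at most \<open>s / n\<close>. Truncation at
  1 lets an arbitrarily heavy item count only once.\<close>

lemma win_prob_lower:
  assumes pos: "\<And>i. i \<in> {1..n} \<Longrightarrow> 0 < w i" and s: "1 \<le> s" "s \<le> n" and i: "i \<in> {1..n}"
  shows "real s / n * (1 - real s / n * (\<Sum>j\<in>{1..n} - {i}. min 1 (w j / w i))) \<le> win_prob w n s i"
proof -
  let ?F = "subset_family n s" and ?y = "\<lambda>j. min 1 (w j / w i)"
  let ?A = "{1..n} - {i}"
  define c1 where "c1 = card {S \<in> ?F. i \<in> S}"
  define Y where "Y = (\<Sum>j\<in>?A. ?y j)"
  have wi: "0 < w i" by (rule pos[OF i])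
  have y0: "0 \<le> ?y j" if "j \<in> {1..n}" for j using pos[OF that] wi by auto
  have n0: "0 < n" using s by auto
  have F0: "0 < card ?F" using s by (simp add: card_subset_family)
  have F1: "real n * c1 = s * card ?F"
  proof -
    have "c1 = (n - 1) choose (s - 1)"
      using card_subsets_above[of "{1..n}" "{i}" s] i s
      by (simp add: c1_def subset_family_def conj_ac)
    then have "n * c1 = s * card ?F"
      using times_binomial_minus1_eq[of s n] s by (simp add: card_subset_family)
    then show ?thesis by (metis of_nat_mult)
  qed
  have F2: "real n * card {S \<in> ?F. i \<in> S \<and> j \<in> S} \<le> s * c1" if j: "j \<in> ?A" for j
  proof (cases "2 \<le> s")
    case True
    have c1: "c1 = (n - 1) choose (s - 1)"
      using card_subsets_above[of "{1..n}" "{i}" s] i s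
      by (simp add: c1_def subset_family_def conj_ac)
    have "card {S \<in> ?F. i \<in> S \<and> j \<in> S} = (n - 2) choose (s - 2)"
      using card_subsets_above[of "{1..n}" "{i, j}" s] i j True
      by (simp add: subset_family_def conj_ac numeral_2_eq_2)
    then have *: "(n - 1) * card {S \<in> ?F. i \<in> S \<and> j \<in> S} = (s - 1) * c1"
      using times_binomial_minus1_eq[of "s - 1" "n - 1"] True c1 by (simp add: numeral_2_eq_2)
    let ?c = "real (card {S \<in> ?F. i \<in> S \<and> j \<in> S})"
    have *: "(real n - 1) * ?c = (real s - 1) * c1"
      using arg_cong[OF *, of real] s n0 by (simp add: of_nat_diff)
    \<comment> \<open>Adding this to the identity turns the exact ratio
      \<open>(s - 1) / (n - 1)\<close> into the bound \<open>s / n\<close>.\<close>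
    have "?c \<le> c1"
      unfolding c1_def of_nat_le_iff by (intro card_mono) auto
    with * show ?thesis by (simp add: algebra_simps)
  next
    case False
    have "{S \<in> ?F. i \<in> S \<and> j \<in> S} = {}"
    proof safe
      fix S assume S: "S \<in> ?F" "i \<in> S" "j \<in> S"
      then have "card {i, j} \<le> card S" using finite_subset_familyD by (intro card_mono) auto
      then show "S \<in> {}" using S j False by (auto simp: subset_family_def)
    qed
    then show ?thesis by (simp only: card.empty)
  qed
  have "real (card {S \<in> ?F. i \<in> S}) - (\<Sum>j\<in>?A. ?y j * card {S \<in> ?F. i \<in> S \<and> j \<in> S})
     = (\<Sum>S\<in>{S \<in> ?F. i \<in> S}. 1 - (\<Sum>j\<in>?A. ?y j * (if j \<in> S then 1 else 0)))"
  proof -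
    have "(\<Sum>S\<in>{S \<in> ?F. i \<in> S}. \<Sum>j\<in>?A. ?y j * (if j \<in> S then 1 else 0))
       = (\<Sum>j\<in>?A. ?y j * (\<Sum>S\<in>{S \<in> ?F. i \<in> S}. if j \<in> S then 1 else 0))"
      by (subst sum.swap) (simp add: sum_distrib_left)
    also have "\<dots> = (\<Sum>j\<in>?A. ?y j * card {S \<in> ?F. i \<in> S \<and> j \<in> S})"
    proof (intro sum.cong refl arg_cong2[of _ _ _ _ "(*)"])
      fix j
      have "{S \<in> ?F. i \<in> S} \<inter> {S. j \<in> S} = {S \<in> ?F. i \<in> S \<and> j \<in> S}" by auto
      then show "(\<Sum>S\<in>{S \<in> ?F. i \<in> S}. if j \<in> S then 1 else 0) = real (card {S \<in> ?F. i \<in> S \<and> j \<in> S})"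
        by (subst sum.inter_filter[symmetric]) (auto simp: conj_ac)
    qed
    finally show ?thesis by (simp add: sum_subtractf)
  qed
  also have "\<dots> \<le> (\<Sum>S\<in>{S \<in> ?F. i \<in> S}. w i / sum w S)"
  proof (rule sum_mono)
    fix S assume S': "S \<in> {S \<in> ?F. i \<in> S}"
    then have "finite S" by (intro finite_subset_familyD[of S n s]) simp
    with S' have S: "i \<in> S" "finite S" "S \<subseteq> {1..n}"
      by (simp_all add: subset_family_def)
    have "(\<Sum>j\<in>?A. ?y j * (if j \<in> S then 1 else 0)) = (\<Sum>j\<in>?A. if j \<in> S then ?y j else 0)"
      by (intro sum.cong) simp_all
    also have "\<dots> = (\<Sum>j\<in>{j \<in> ?A. j \<in> S}. ?y j)"
      by (rule sum.inter_filter[symmetric]) simp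
    also have "{j \<in> ?A. j \<in> S} = S - {i}" using S by auto
    finally have e: "(\<Sum>j\<in>?A. ?y j * (if j \<in> S then 1 else 0)) = (\<Sum>j\<in>S - {i}. ?y j)" .
    have sumS: "sum w S = w i + sum w (S - {i})" using S by (simp add: sum.remove)
    have R0: "0 \<le> sum w (S - {i})" using S(3) by (intro sum_nonneg less_imp_le pos) blast
    have "1 - (\<Sum>j\<in>S - {i}. ?y j) \<le> w i / sum w S"
    proof (cases "\<forall>j\<in>S - {i}. w j \<le> w i")
      case True
      then have "(\<Sum>j\<in>S - {i}. ?y j) = (\<Sum>j\<in>S - {i}. w j / w i)"
        using wi by (intro sum.cong) auto
      also have "\<dots> = sum w (S - {i}) / w i" by (simp add: sum_divide_distrib)
      finally have *: "(\<Sum>j\<in>S - {i}. ?y j) = sum w (S - {i}) / w i" .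
      have "(w i - sum w (S - {i})) * (w i + sum w (S - {i})) \<le> w i * w i"
        by (simp add: algebra_simps)
      then show ?thesis unfolding * sumS using wi R0
        by (simp add: field_simps)
    next
      case False
      then obtain j where j: "j \<in> S - {i}" "w i < w j" by force
      have "?y j \<le> (\<Sum>j\<in>S - {i}. ?y j)"
        using j S y0 by (intro member_le_sum) auto
      moreover have "?y j = 1" using j wi by auto
      moreover have "0 \<le> w i / sum w S" using wi R0 sumS by auto
      ultimately show ?thesis by linarith
    qed
    then show "1 - (\<Sum>j\<in>?A. ?y j * (if j \<in> S then 1 else 0)) \<le> w i / sum w S"
      using e by simp
  qed
  also have "\<dots> = win_prob w n s i * card ?F"
  proof -
    have "win_prob w n s i = (\<Sum>S\<in>?F. if i \<in> S then w i / sum w S else 0) / card ?F"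
      using pos s by (intro win_prob_eq) auto
    then show ?thesis using F0 by (simp add: sum.inter_filter)
  qed
  finally have main: "c1 - (\<Sum>j\<in>?A. ?y j * card {S \<in> ?F. i \<in> S \<and> j \<in> S}) \<le> win_prob w n s i * card ?F"
    by (simp add: c1_def)
  have "(\<Sum>j\<in>?A. ?y j * card {S \<in> ?F. i \<in> S \<and> j \<in> S}) \<le> (\<Sum>j\<in>?A. ?y j * (s * c1 / n))"
    using F2 n0 y0 by (intro sum_mono mult_left_mono) (auto simp: field_simps)
  also have "\<dots> = Y * (s * c1 / n)" unfolding Y_def by (rule sum_distrib_right[symmetric])
  finally have "c1 * (1 - s / n * Y) \<le> win_prob w n s i * card ?F"
    using main by (simp add: algebra_simps)
  moreover have "c1 = s / n * card ?F" using F1 n0 by (simp add: field_simps)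
  ultimately have "(s / n * (1 - s / n * Y)) * card ?F \<le> win_prob w n s i * card ?F"
    by (simp add: mult_ac)
  then have "s / n * (1 - s / n * Y) \<le> win_prob w n s i"
    by (rule mult_right_le_imp_le) (use F0 in simp)
  then show ?thesis unfolding Y_def .
qed


section \<open>Screening\<close>

text \<open>An item with a win rate of the order of \<open>s / n\<close> then has an expected number
  of wins of the order of \<open>K\<close>, whatever \<open>s\<close> is.\<close>

abbreviation screen_samples :: "real \<Rightarrow> nat \<Rightarrow> nat \<Rightarrow> nat" where
  "screen_samples K n s \<equiv> nat \<lceil>K * real n / real s\<rceil>"

text \<open>
  At set size \<open>s\<close>, an item has a win rate of at most \<open>s / n\<close>. Once \<open>k\<close> items have a win rate of
  at least \<open>s / (4 n)\<close>, so do all top items, by monotonicity. This is how the right scale is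
  recognized without knowing the scores.
\<close>

primrec screen :: "real \<Rightarrow> nat \<Rightarrow> nat \<Rightarrow> nat \<Rightarrow> nat \<Rightarrow> nat list prog" where
  "screen K n k 0 s = Ret [1..<Suc n]"
| "screen K n k (Suc d) s = (if s < 2 then Ret [1..<Suc n]
     else bindp (sample (pmf_of_set (subset_family n s)) (screen_samples K n s)) (\<lambda>as.
       if k \<le> card {i \<in> {1..n}. 3 / 8 * (s / n) * screen_samples K n s \<le> count_list as i}
       then Ret (filter (\<lambda>i. i \<in> set as) [1..<Suc n])
       else screen K n k d (s div 2)))"

lemma validp_screen: "s \<le> l \<Longrightarrow> s \<le> n \<Longrightarrow> validp n l (screen K n k d s)"
proof (induction d arbitrary: s)
  case (Suc d)
  have "validp n l (sample (pmf_of_set (subset_family n s)) N)" if "2 \<le> s" for N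
  proof (rule validp_sample)
    fix S assume "S \<in> set_pmf (pmf_of_set (subset_family n s))"
    then have "S \<in> subset_family n s"
      using Suc.prems subset_family_nonempty by simp
    then show "S \<subseteq> {1..n} \<and> 2 \<le> card S \<and> card S \<le> l"
      using Suc.prems that by (auto simp: subset_family_def)
  qed
  moreover have "validp n l (screen K n k d (s div 2))" using Suc by simp
  ultimately show ?case by (auto intro!: validp_bind)
qed simp

lemma ok_sample_length: "ok w N 0 (sample D N) (\<lambda>as. length as = N)"
proof -
  have "err w (\<lambda>as. length as = N) (sample D N) N = 0"
    by (induction N) (auto simp: err_bind_Ret)
  then show ?thesis by (simp add: ok_def)
qed

text \<open>The threshold 3/8 is the midpoint of 1/4 and 1/2. With \<open>\<kappa> = 1/8\<close> and
  \<open>\<kappa> = -1/8\<close> the exponents per sample are at most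
  \<open>- 3/256 * (s / n)\<close> and \<open>- 1/128 * (s / n)\<close>; the second gives the
  constant 128. The factor 3 is the union bound over the three implications.\<close>

lemma ok_screen_step:
  assumes s: "1 \<le> s" "s \<le> n" and N: "K * n / s \<le> real N" and K: "0 \<le> K" and i: "i \<in> {1..n}"
  shows "ok w N (3 * exp (- K / 128)) (sample (pmf_of_set (subset_family n s)) N) (\<lambda>as.
     (win_prob w n s i \<le> 1 / 4 * (s / n) \<longrightarrow> real (count_list as i) < 3 / 8 * (s / n) * N) \<and>
     (1 / 2 * (s / n) \<le> win_prob w n s i \<longrightarrow> 3 / 8 * (s / n) * N \<le> real (count_list as i)) \<and>
     (1 / 4 * (s / n) \<le> win_prob w n s i \<longrightarrow> i \<in> set as))"
proof -
  let ?D = "pmf_of_set (subset_family n s)" and ?t = "3 / 8 * (s / n)"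
  define q where "q = win_prob w n s i"
  define u where "u = real s / n"
  have q: "pmf (answer w ?D) i = q" by (simp add: q_def win_prob_def)
  have q01: "0 \<le> q" "q \<le> 1" by (simp_all add: q_def win_prob_def pmf_le_1)
  have u: "0 < u" using s by (simp add: u_def)
  have Nu: "K \<le> N * u" using N s by (simp add: u_def field_simps)
  have exp_bound: "exp (real N * z) \<le> exp (- K / 128)" if "z \<le> - u / 128" for z
  proof -
    have "real N * z \<le> real N * (- u / 128)" using that by (intro mult_left_mono) auto
    then show ?thesis using Nu by simp
  qed
  have trivial: "ok w N (exp (- K / 128)) (sample ?D N) Q"
    if "\<And>as. Q as" for Q
    by (rule ok_mono[OF ok_sample_length]) (use that in auto)
  have A: "ok w N (exp (- K / 128)) (sample ?D N)
     (\<lambda>as. q \<le> 1 / 4 * u \<longrightarrow> real (count_list as i) < 3 / 8 * u * N)"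
  proof (cases "q \<le> 1 / 4 * u")
    case True
    have "ok w N (exp (real N * (pmf (answer w ?D) i * (1/8 + (1/8)\<^sup>2) - 1/8 * (3 / 8 * u)))) (sample ?D N)
       (\<lambda>as. real (count_list as i) < 3 / 8 * u * N)"
      by (rule ok_sample_exp) auto
    then show ?thesis
      by (rule ok_mono[OF _ _ exp_bound]) (use True u q in \<open>auto simp: power2_eq_square\<close>)
  qed (rule trivial, simp)
  have B: "ok w N (exp (- K / 128)) (sample ?D N)
     (\<lambda>as. 1 / 2 * u \<le> q \<longrightarrow> 3 / 8 * u * N \<le> real (count_list as i))"
  proof (cases "1 / 2 * u \<le> q")
    case True
    have "ok w N (exp (real N * (pmf (answer w ?D) i * (-1/8 + (-1/8)\<^sup>2) - (-1/8) * (3 / 8 * u)))) (sample ?D N)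
       (\<lambda>as. 3 / 8 * u * N \<le> real (count_list as i))"
      by (rule ok_sample_exp) auto
    then show ?thesis
      by (rule ok_mono[OF _ _ exp_bound]) (use True u q in \<open>auto simp: power2_eq_square\<close>)
  qed (rule trivial, simp)
  have C: "ok w N (exp (- K / 128)) (sample ?D N) (\<lambda>as. 1 / 4 * u \<le> q \<longrightarrow> i \<in> set as)"
  proof (cases "1 / 4 * u \<le> q")
    case True
    have "ok w N (exp (- u / 128) ^ N) (sample ?D N) (\<lambda>as. i \<in> set as)"
    proof (rule ok_sample[of 0 1 _ _ i])
      have "1 - q \<le> 1 - u / 128" using True u by simp
      also have "\<dots> \<le> exp (- u / 128)" using exp_ge_add_one_self[of "- u / 128"] by simp
      finally show "0 * pmf (answer w ?D) i + 1 * (1 - pmf (answer w ?D) i) \<le> exp (- u / 128)"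
        using q by simp
    qed (auto simp: count_notin)
    also have "exp (- u / 128) ^ N = exp (real N * (- u / 128))" by (rule exp_of_nat_mult[symmetric])
    finally have "ok w N (exp (real N * (- u / 128))) (sample ?D N) (\<lambda>as. i \<in> set as)" .
    then show ?thesis
      by (rule ok_mono[OF _ _ exp_bound]) auto
  qed (rule trivial, simp)
  show ?thesis
    using ok_conj[OF A ok_conj[OF B C]]
    by (rule ok_mono) (auto simp: u_def q_def)
qed

text \<open>The invariant is that the sample size at the current \<open>s\<close> is at most
  \<open>m\<close>. If the test fails, some top item has a win rate below \<open>s / (2 n)\<close>,
  and \<open>win_prob_lower\<close> forces \<open>n < 2 * M * s\<close>. So \<open>s\<close> is
  still large enough that one more halving keeps the sample size of the order of
  \<open>K * M\<close>. At \<open>s = 1\<close> no legal query is left and all items are returned,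
  which is affordable because \<open>n \<le> 6 * M\<close> by then.\<close>

lemma ok_screen:
  fixes w :: "nat \<Rightarrow> real" and K M :: real
  assumes pos: "\<And>i. i \<in> {1..n} \<Longrightarrow> 0 < w i" and K: "0 < K"
    and T: "T \<subseteq> {1..n}" "card T = k"
    and B: "\<And>t b. t \<in> T \<Longrightarrow> b \<in> {1..n} - T \<Longrightarrow> w b \<le> w t"
    and M: "\<And>t. t \<in> T \<Longrightarrow> (\<Sum>j\<in>{1..n} - {t}. min 1 (w j / w t)) \<le> M"
    and m: "6 * K * M + 1 \<le> m" "6 * M \<le> m"
    and "s < 2 ^ Suc d" "1 \<le> s" "s \<le> n" "screen_samples K n s \<le> m" "s < 2 \<Longrightarrow> n \<le> m"
  shows "ok w (d * m) (real (d * n) * (3 * exp (- K / 128))) (screen K n k d s)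
     (\<lambda>C. T \<subseteq> set C \<and> set C \<subseteq> {1..n} \<and> distinct C \<and> length C \<le> m)"
proof -
  have all: "set [1..<Suc n] = {1..n}" by auto
  have triv: "ok w m' \<delta> (Ret [1..<Suc n])
     (\<lambda>C. T \<subseteq> set C \<and> set C \<subseteq> {1..n} \<and> distinct C \<and> length C \<le> m)"
    if "n \<le> m" "0 \<le> \<delta>" for m' and \<delta> :: real
  proof (rule ok_Ret)
    show "T \<subseteq> set [1..<Suc n] \<and> set [1..<Suc n] \<subseteq> {1..n} \<and> distinct [1..<Suc n]
        \<and> length [1..<Suc n] \<le> m"
      using that T unfolding all by (simp del: upt_Suc)
  qed fact
  show ?thesis
    using assms(9-13)
  proof (induction d arbitrary: s)
    case 0
    then have "n \<le> m" by simp
    then show ?case unfolding screen.simps by (rule triv) simp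
  next
    case (Suc d)
    let ?D = "pmf_of_set (subset_family n s)" and ?N = "screen_samples K n s"
    let ?\<delta> = "3 * exp (- K / 128)"
    let ?Q = "\<lambda>C. T \<subseteq> set C \<and> set C \<subseteq> {1..n} \<and> distinct C \<and> length C \<le> m"
    show ?case
    proof (cases "s < 2")
      case True
      then have "n \<le> m" using Suc.prems by simp
      have return: "screen K n k (Suc d) s = Ret [1..<Suc n]" using True by simp
      show ?thesis unfolding return by (rule triv) (use \<open>n \<le> m\<close> in auto)
    next
      case False
      have n0: "0 < n" using Suc.prems by auto
      have N: "K * n / s \<le> real ?N" by linarith
      let ?G = "\<lambda>as i.
        (win_prob w n s i \<le> 1 / 4 * (s / n) \<longrightarrow> real (count_list as i) < 3 / 8 * (s / n) * ?N) \<and>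
        (1 / 2 * (s / n) \<le> win_prob w n s i \<longrightarrow> 3 / 8 * (s / n) * ?N \<le> real (count_list as i)) \<and>
        (1 / 4 * (s / n) \<le> win_prob w n s i \<longrightarrow> i \<in> set as)"
      have "ok w ?N (real (card {1..n}) * ?\<delta>) (sample ?D ?N) (\<lambda>as. \<forall>i\<in>{1..n}. ?G as i)"
        using Suc.prems K N n0 by (intro ok_ball ok_screen_step) auto
      from ok_conj[OF this ok_sample_length]
      have good: "ok w ?N (n * ?\<delta>) (sample ?D ?N) (\<lambda>as. (\<forall>i\<in>{1..n}. ?G as i) \<and> length as = ?N)"
        by simp
      have "ok w (?N + d * m) (n * ?\<delta> + real (d * n) * ?\<delta>) (bindp (sample ?D ?N) (\<lambda>as.
         if k \<le> card {i \<in> {1..n}. 3 / 8 * (s / n) * ?N \<le> count_list as i}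
         then Ret (filter (\<lambda>i. i \<in> set as) [1..<Suc n])
         else screen K n k d (s div 2))) ?Q"
      proof (rule ok_bind[OF good])
        fix as assume as: "(\<forall>i\<in>{1..n}. ?G as i) \<and> length as = ?N"
        let ?H = "{i \<in> {1..n}. 3 / 8 * (s / n) * ?N \<le> count_list as i}"
        show "ok w (d * m) (real (d * n) * ?\<delta>)
          (if k \<le> card ?H then Ret (filter (\<lambda>i. i \<in> set as) [1..<Suc n]) else screen K n k d (s div 2)) ?Q"
        proof (cases "k \<le> card ?H")
          case True
          have H: "1 / 4 * (s / n) \<le> win_prob w n s i" if "i \<in> ?H" for i
            using that as by force
          have "t \<in> set as" if t: "t \<in> T" for t
          proof -
            have tn: "t \<in> {1..n}" using t T by auto
            have "1 / 4 * (s / n) \<le> win_prob w n s t"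
            proof (cases "t \<in> ?H")
              case False
              \<comment> \<open>Pigeonhole: the \<open>k\<close> or more items of \<open>?H\<close>
                do not fit into the other \<open>k - 1\<close> top items. So one of them lies
                outside \<open>T\<close>, is no heavier than \<open>t\<close>, and still has a high
                win rate.\<close>
              have "\<not> ?H \<subseteq> T - {t}"
              proof
                assume "?H \<subseteq> T - {t}"
                then have "card ?H \<le> card (T - {t})"
                  using T by (intro card_mono) (auto intro: finite_subset)
                also have "\<dots> < card T"
                  using t T finite_subset[of T "{1..n}"] by (intro psubset_card_mono) auto
                finally show False using True T by simp
              qed
              then obtain b where b: "b \<in> ?H" "b \<notin> T" using False by blast
              have "win_prob w n s b \<le> win_prob w n s t"
                using pos Suc.prems tn b B[OF t, of b] by (intro win_prob_mono) auto
              then show ?thesis using H[OF b(1)] by linarith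
            qed (rule H)
            then show ?thesis using as tn by blast
          qed
          \<comment> \<open>Every query has a single winner, so the sample size also bounds the
            number of candidates.\<close>
          moreover have "length (filter (\<lambda>i. i \<in> set as) [1..<Suc n]) \<le> m"
          proof -
            have "length (filter (\<lambda>i. i \<in> set as) [1..<Suc n]) = card (set (filter (\<lambda>i. i \<in> set as) [1..<Suc n]))"
              by (rule distinct_card[symmetric]) (simp del: upt_Suc)
            also have "\<dots> \<le> card (set as)" by (intro card_mono) auto
            also have "\<dots> \<le> length as" by (rule card_length)
            also have "\<dots> \<le> m" using as Suc.prems by simp
            finally show ?thesis .
          qed
          ultimately have "?Q (filter (\<lambda>i. i \<in> set as) [1..<Suc n])"
            using T by (auto simp del: upt_Suc)
          then show ?thesis using True by (simp add: ok_Ret del: upt_Suc)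
        next
          case no: False
          have "\<not> T \<subseteq> ?H"
            using no T card_mono[of ?H T] by auto
          then obtain t where t: "t \<in> T" "t \<notin> ?H" by blast
          have tn: "t \<in> {1..n}" using t T by auto
          have "win_prob w n s t < 1 / 2 * (s / n)"
            using as t tn by force
          then have "win_prob w n s t < s / n * (1 / 2)" by simp
          moreover have "s / n * (1 - s / n * (\<Sum>j\<in>{1..n} - {t}. min 1 (w j / w t))) \<le> win_prob w n s t"
            using pos Suc.prems tn by (intro win_prob_lower) auto
          ultimately have "s / n * (1 - s / n * (\<Sum>j\<in>{1..n} - {t}. min 1 (w j / w t))) < s / n * (1 / 2)"
            by (rule le_less_trans[rotated])
          then have "1 - s / n * (\<Sum>j\<in>{1..n} - {t}. min 1 (w j / w t)) < 1 / 2"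
            using n0 Suc.prems by (subst (asm) mult_less_cancel_left_pos) auto
          moreover have "s / n * (\<Sum>j\<in>{1..n} - {t}. min 1 (w j / w t)) \<le> s / n * M"
            using M[OF t(1)] by (intro mult_left_mono) auto
          ultimately have "1 / 2 < s / n * M" by linarith
          then have sM: "real n < 2 * M * s" using n0 by (simp add: field_simps)
          let ?s = "s div 2"
          \<comment> \<open>The worst case is \<open>s = 3\<close>. Together with
            \<open>n < 2 * M * s\<close> it explains the factor 6 in the assumptions on
            \<open>m\<close>.\<close>
          have s3: "real s \<le> 3 * real ?s" proof -
            have "s \<le> 3 * ?s" using False by presburger
            then show ?thesis by linarith
          qed
          have M0: "0 < M"
          proof (rule ccontr)
            assume "\<not> 0 < M"
            then have "2 * M * s \<le> 0" by (simp add: mult_nonpos_nonneg)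
            then show False using sM by simp
          qed
          have nM: "real n \<le> 6 * M * ?s"
          proof -
            have "2 * M * s \<le> 2 * M * (3 * real ?s)" using M0 s3 by (intro mult_left_mono) auto
            then show ?thesis using sM by simp
          qed
          have "screen_samples K n ?s \<le> m"
          proof -
            have "K * n / ?s \<le> 6 * K * M"
            proof -
              have "K * n \<le> K * (6 * M * ?s)" using K nM by (intro mult_left_mono) auto
              then show ?thesis using False by (simp add: pos_divide_le_eq mult_ac)
            qed
            then have "K * n / ?s + 1 \<le> m" using m by linarith
            then show ?thesis by linarith
          qed
          moreover have "n \<le> m" if "?s < 2"
          proof -
            have "?s = 1" using that False by presburger
            then have "real n \<le> m" using nM m by simp
            then show ?thesis by simp
          qed
          ultimately have "ok w (d * m) (real (d * n) * ?\<delta>) (screen K n k d ?s) ?Q"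
            using Suc.prems False by (intro Suc.IH) auto
          then show ?thesis using no by simp
        qed
      qed simp
      then show ?thesis
        using False Suc.prems
        by (auto simp: algebra_simps elim!: ok_mono simp del: upt_Suc)
    qed
  qed
qed


section \<open>Noisy merge sort\<close>

fun merge :: "nat \<Rightarrow> nat \<Rightarrow> nat list \<Rightarrow> nat list \<Rightarrow> nat list prog" where
  "merge n N (x # xs) (y # ys) = bindp (estimate n N x y) (\<lambda>e.
     if 1 / 2 \<le> e then bindp (merge n N xs (y # ys)) (\<lambda>zs. Ret (x # zs))
     else bindp (merge n N (x # xs) ys) (\<lambda>zs. Ret (y # zs)))"
| "merge n N [] ys = Ret ys"
| "merge n N xs [] = Ret xs"

primrec msort :: "nat \<Rightarrow> nat \<Rightarrow> nat \<Rightarrow> nat list \<Rightarrow> nat list prog" where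
  "msort n N 0 xs = Ret xs"
| "msort n N (Suc d) xs =
     bindp (msort n N d (take (length xs div 2) xs)) (\<lambda>ys.
     bindp (msort n N d (drop (length xs div 2) xs)) (\<lambda>zs. merge n N ys zs))"

lemma validp_merge: "2 \<le> l \<Longrightarrow> validp n l (merge n N xs ys)"
  by (induction n N xs ys rule: merge.induct) (auto intro!: validp_bind validp_estimate)

lemma validp_msort: "2 \<le> l \<Longrightarrow> validp n l (msort n N d xs)"
  by (induction d arbitrary: xs) (auto intro!: validp_bind validp_merge)

text \<open>All pairs are constrained, not only neighbours, because the relation with a factor
  \<alpha> is not transitive.\<close>

definition roughly_sorted :: "(nat \<Rightarrow> real) \<Rightarrow> real \<Rightarrow> nat list \<Rightarrow> bool" where
  "roughly_sorted w \<alpha> = sorted_wrt (\<lambda>x y. w y \<le> \<alpha> * w x)"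

text \<open>An estimate on the wrong side of 1/2 by at most \<epsilon> bounds the ratio of the
  scores by \<open>(1 + 2 * \<epsilon>) / (1 - 2 * \<epsilon>)\<close>. The condition on \<beta>
  makes this at most \<beta>.\<close>

lemma ratio_of_estimate:
  fixes x y e \<epsilon> \<beta> :: real
  assumes "0 < x" "0 < y" "\<bar>e - x / (x + y)\<bar> \<le> \<epsilon>" "0 \<le> \<epsilon>" "1 \<le> \<beta>" "4 * \<epsilon> * \<beta> \<le> \<beta> - 1"
  shows "1 / 2 \<le> e \<Longrightarrow> y \<le> \<beta> * x" "e < 1 / 2 \<Longrightarrow> x \<le> \<beta> * y"
proof -
  have aux: "b \<le> \<beta> * a" if "1 / 2 - \<epsilon> \<le> a / (a + b)" "0 < a" "0 < b" for a b :: real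
  proof -
    have "(1 / 2 - \<epsilon>) * (a + b) \<le> a" using that by (simp add: field_simps)
    then have 1: "b * (1 - 2 * \<epsilon>) \<le> a * (1 + 2 * \<epsilon>)" by (simp add: algebra_simps)
    have "1 + 2 * \<epsilon> \<le> \<beta> * (1 - 2 * \<epsilon>)"
    proof -
      have "2 * \<epsilon> * 1 \<le> 2 * \<epsilon> * \<beta>" using assms by (intro mult_left_mono) auto
      then show ?thesis using assms by (simp add: algebra_simps)
    qed
    then have "a * (1 + 2 * \<epsilon>) \<le> a * (\<beta> * (1 - 2 * \<epsilon>))" using that by (intro mult_left_mono) auto
    with 1 have 2: "b * (1 - 2 * \<epsilon>) \<le> (\<beta> * a) * (1 - 2 * \<epsilon>)" by (simp add: mult_ac)
    have "0 < 1 - 2 * \<epsilon>"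
    proof (rule ccontr)
      assume "\<not> ?thesis"
      then have "1 / 2 * \<beta> \<le> \<epsilon> * \<beta>" using assms by (intro mult_right_mono) auto
      then show False using assms by linarith
    qed
    with 2 show ?thesis by simp
  qed
  show "y \<le> \<beta> * x" if "1 / 2 \<le> e" by (rule aux) (use that assms in auto)
  show "x \<le> \<beta> * y" if "e < 1 / 2"
  proof (rule aux)
    have "y / (y + x) = 1 - x / (x + y)" using assms by (simp add: field_simps)
    then show "1 / 2 - \<epsilon> \<le> y / (y + x)" using that assms by linarith
  qed (use assms in auto)
qed

text \<open>Errors do not accumulate along a merge. When a head is output, later elements of its own
  list are within \<alpha> of it, the other head is within \<beta>, and the rest of the other list
  is within \<open>\<alpha> * \<beta>\<close> by way of that head. So a whole merge costs a single
  factor \<beta>, and each comparison outputs one element.\<close>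

lemma ok_merge:
  fixes n N :: nat and \<epsilon> \<alpha> \<beta> :: real
  defines "\<delta> \<equiv> 2 * exp (- real N * \<epsilon>\<^sup>2 / 4)"
  assumes pos: "\<And>i. i \<in> {1..n} \<Longrightarrow> 0 < w i" and N: "0 < N"
    and \<epsilon>: "0 \<le> \<epsilon>" "\<epsilon> \<le> 1" and \<beta>: "1 \<le> \<beta>" "4 * \<epsilon> * \<beta> \<le> \<beta> - 1" and \<alpha>: "1 \<le> \<alpha>"
    and "roughly_sorted w \<alpha> xs" "roughly_sorted w \<alpha> ys" "set xs \<subseteq> {1..n}" "set ys \<subseteq> {1..n}"
  shows "ok w ((length xs + length ys) * N) (real (length xs + length ys) * \<delta>) (merge n N xs ys)
     (\<lambda>zs. mset zs = mset xs + mset ys \<and> roughly_sorted w (\<alpha> * \<beta>) zs)"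
  using assms(9-12)
proof (induction "length xs + length ys" arbitrary: xs ys rule: less_induct)
  case less
  have \<delta>0: "0 \<le> \<delta>" by (simp add: \<delta>_def)
  have weaken: "w b \<le> \<alpha> * \<beta> * w a" if "w b \<le> \<alpha> * w a" "0 < w a" for a b
  proof -
    have "\<alpha> * w a * 1 \<le> \<alpha> * w a * \<beta>" using \<alpha> \<beta> that by (intro mult_left_mono) auto
    then show ?thesis using that by (simp add: mult_ac)
  qed
  have through: "w c \<le> \<alpha> * \<beta> * w a" if "w b \<le> \<beta> * w a" "w c \<le> \<alpha> * w b" for a b c
  proof -
    have "\<alpha> * w b \<le> \<alpha> * (\<beta> * w a)" using \<alpha> that by (intro mult_left_mono) auto
    then show ?thesis using that by (simp add: mult_ac)
  qed
  have near: "w b \<le> \<alpha> * \<beta> * w a" if "w b \<le> \<beta> * w a" "0 < w b" for a b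
    using that \<alpha> mult_right_mono[of 1 \<alpha> "\<beta> * w a"] by (simp add: mult_ac)
  have weaken_sorted: "roughly_sorted w (\<alpha> * \<beta>) us" if "roughly_sorted w \<alpha> us" "set us \<subseteq> {1..n}" for us
    using that pos unfolding roughly_sorted_def
    by (auto elim!: sorted_wrt_mono_rel[rotated] intro!: weaken)
  show ?case
  proof (cases xs)
    case Nil
    then show ?thesis using less.prems weaken_sorted \<delta>0 by (auto intro!: ok_Ret)
  next
    case xs: (Cons x xs')
    show ?thesis
    proof (cases ys)
      case Nil
      then show ?thesis using less.prems weaken_sorted \<delta>0 xs by (auto intro!: ok_Ret)
    next
      case ys: (Cons y ys')
      have xy: "x \<in> {1..n}" "y \<in> {1..n}" using less.prems xs ys by auto
      let ?Q = "\<lambda>zs. mset zs = mset xs + mset ys \<and> roughly_sorted w (\<alpha> * \<beta>) zs"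
      have "ok w (N + (length xs' + length ys' + 1) * N) (\<delta> + real (length xs' + length ys' + 1) * \<delta>)
          (merge n N xs ys) ?Q"
        unfolding xs ys merge.simps
      proof (rule ok_bind)
        show "ok w N \<delta> (estimate n N x y) (\<lambda>e. \<bar>e - w x / (w x + w y)\<bar> \<le> \<epsilon>)"
          unfolding \<delta>_def using pos N \<epsilon> xy by (intro ok_estimate) auto
        fix e :: real assume e: "\<bar>e - w x / (w x + w y)\<bar> \<le> \<epsilon>"
        show "ok w ((length xs' + length ys' + 1) * N) (real (length xs' + length ys' + 1) * \<delta>)
          (if 1 / 2 \<le> e then bindp (merge n N xs' (y # ys')) (\<lambda>zs. Ret (x # zs))
           else bindp (merge n N (x # xs') ys') (\<lambda>zs. Ret (y # zs)))
          (\<lambda>zs. mset zs = mset (x # xs') + mset (y # ys') \<and> roughly_sorted w (\<alpha> * \<beta>) zs)"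
        proof (cases "1 / 2 \<le> e")
          case True
          have yx: "w y \<le> \<beta> * w x"
            using ratio_of_estimate(1)[OF pos[OF xy(1)] pos[OF xy(2)] e \<epsilon>(1) \<beta> True] .
          have "ok w ((length xs' + length ys) * N) (real (length xs' + length ys) * \<delta>) (merge n N xs' ys)
             (\<lambda>zs. mset zs = mset xs' + mset ys \<and> roughly_sorted w (\<alpha> * \<beta>) zs)"
            using less.prems xs by (intro less.hyps) (auto simp: roughly_sorted_def)
          then have "ok w ((length xs' + length ys) * N) (real (length xs' + length ys) * \<delta>) (merge n N xs' ys)
             (\<lambda>zs. mset (x # zs) = mset xs + mset ys \<and> roughly_sorted w (\<alpha> * \<beta>) (x # zs))"
          proof (rule ok_mono)
            fix zs assume zs: "mset zs = mset xs' + mset ys \<and> roughly_sorted w (\<alpha> * \<beta>) zs"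
            have "set zs = set xs' \<union> set ys" using zs by (metis set_mset_mset set_mset_union)
            moreover have "w z \<le> \<alpha> * \<beta> * w x" if "z \<in> set xs'" for z
              using that less.prems xs pos[OF xy(1)] by (auto simp: roughly_sorted_def intro: weaken)
            moreover have "w z \<le> \<alpha> * \<beta> * w x" if "z \<in> set ys" for z
              using that less.prems ys yx pos[OF xy(2)]
              by (auto simp: roughly_sorted_def intro: near through)
            ultimately show "mset (x # zs) = mset xs + mset ys \<and> roughly_sorted w (\<alpha> * \<beta>) (x # zs)"
              using zs xs by (auto simp: roughly_sorted_def)
          qed auto
          then show ?thesis using True xs ys by (simp add: ok_bind_Ret)
        next
          case False
          have yx: "w x \<le> \<beta> * w y"
            using ratio_of_estimate(2)[OF pos[OF xy(1)] pos[OF xy(2)] e \<epsilon>(1) \<beta>] False by simp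
          have "ok w ((length xs + length ys') * N) (real (length xs + length ys') * \<delta>) (merge n N xs ys')
             (\<lambda>zs. mset zs = mset xs + mset ys' \<and> roughly_sorted w (\<alpha> * \<beta>) zs)"
            using less.prems ys by (intro less.hyps) (auto simp: roughly_sorted_def)
          then have "ok w ((length xs + length ys') * N) (real (length xs + length ys') * \<delta>) (merge n N xs ys')
             (\<lambda>zs. mset (y # zs) = mset xs + mset ys \<and> roughly_sorted w (\<alpha> * \<beta>) (y # zs))"
          proof (rule ok_mono)
            fix zs assume zs: "mset zs = mset xs + mset ys' \<and> roughly_sorted w (\<alpha> * \<beta>) zs"
            have "set zs = set xs \<union> set ys'" using zs by (metis set_mset_mset set_mset_union)
            moreover have "w z \<le> \<alpha> * \<beta> * w y" if "z \<in> set ys'" for z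
              using that less.prems ys pos[OF xy(2)] by (auto simp: roughly_sorted_def intro: weaken)
            moreover have "w z \<le> \<alpha> * \<beta> * w y" if "z \<in> set xs" for z
              using that less.prems xs yx pos[OF xy(1)]
              by (auto simp: roughly_sorted_def intro: near through)
            ultimately show "mset (y # zs) = mset xs + mset ys \<and> roughly_sorted w (\<alpha> * \<beta>) (y # zs)"
              using zs ys by (auto simp: roughly_sorted_def)
          qed auto
          then show ?thesis using False xs ys by (simp add: ok_bind_Ret)
        qed
      qed (use \<delta>0 in auto)
      then show ?thesis by (auto simp: xs ys algebra_simps elim!: ok_mono)
    qed
  qed
qed

lemma ok_msort:
  fixes n N :: nat and \<epsilon> \<beta> :: real
  defines "\<delta> \<equiv> 2 * exp (- real N * \<epsilon>\<^sup>2 / 4)"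
  assumes pos: "\<And>i. i \<in> {1..n} \<Longrightarrow> 0 < w i" and N: "0 < N"
    and \<epsilon>: "0 \<le> \<epsilon>" "\<epsilon> \<le> 1" and \<beta>: "1 \<le> \<beta>" "4 * \<epsilon> * \<beta> \<le> \<beta> - 1"
    and "length xs \<le> 2 ^ d" "set xs \<subseteq> {1..n}"
  shows "ok w (d * length xs * N) (real (d * length xs) * \<delta>) (msort n N d xs)
     (\<lambda>zs. mset zs = mset xs \<and> roughly_sorted w (\<beta> ^ d) zs)"
  using assms(8-9)
proof (induction d arbitrary: xs)
  case 0
  then show ?case by (cases xs) (auto simp: roughly_sorted_def intro!: ok_Ret)
next
  case (Suc d)
  have \<delta>0: "0 \<le> \<delta>" by (simp add: \<delta>_def)
  let ?h = "length xs div 2"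
  let ?ys = "take ?h xs" and ?zs = "drop ?h xs"
  have len: "length ?ys \<le> 2 ^ d" "length ?zs \<le> 2 ^ d" using Suc.prems by auto
  have sub: "set ?ys \<subseteq> {1..n}" "set ?zs \<subseteq> {1..n}"
    using Suc.prems set_take_subset[of ?h xs] set_drop_subset[of ?h xs] by blast+
  have total: "length ?ys + length ?zs = length xs" by simp
  have "ok w (d * length ?ys * N + (d * length ?zs * N + length xs * N))
      (real (d * length ?ys) * \<delta> + (real (d * length ?zs) * \<delta> + real (length xs) * \<delta>))
      (msort n N (Suc d) xs) (\<lambda>zs. mset zs = mset xs \<and> roughly_sorted w (\<beta> ^ Suc d) zs)"
    unfolding msort.simps
  proof (intro ok_bind)
    show "ok w (d * length ?ys * N) (real (d * length ?ys) * \<delta>) (msort n N d ?ys)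
       (\<lambda>us. mset us = mset ?ys \<and> roughly_sorted w (\<beta> ^ d) us)"
      by (rule Suc.IH) fact+
    show "ok w (d * length ?zs * N) (real (d * length ?zs) * \<delta>) (msort n N d ?zs)
       (\<lambda>us. mset us = mset ?zs \<and> roughly_sorted w (\<beta> ^ d) us)"
      by (rule Suc.IH) fact+
    fix us vs
    assume us: "mset us = mset ?ys \<and> roughly_sorted w (\<beta> ^ d) us"
      and vs: "mset vs = mset ?zs \<and> roughly_sorted w (\<beta> ^ d) vs"
    have l: "length us + length vs = length xs"
      using us vs total by (metis mset_eq_length)
    have s: "set us \<subseteq> {1..n}" "set vs \<subseteq> {1..n}"
      using us vs sub by (metis mset_eq_setD)+
    have m: "mset us + mset vs = mset xs"
      using us vs by (metis append_take_drop_id mset_append)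
    have "ok w ((length us + length vs) * N) (real (length us + length vs) * \<delta>) (merge n N us vs)
      (\<lambda>zs. mset zs = mset us + mset vs \<and> roughly_sorted w (\<beta> ^ d * \<beta>) zs)"
      unfolding \<delta>_def using pos N \<epsilon> \<beta> us vs s
      by (intro ok_merge) auto
    then show "ok w (length xs * N) (real (length xs) * \<delta>) (merge n N us vs)
      (\<lambda>zs. mset zs = mset xs \<and> roughly_sorted w (\<beta> ^ Suc d) zs)"
      using l m by (simp add: mult_ac)
  qed (use \<delta>0 in auto)
  moreover have "d * length ?ys * N + (d * length ?zs * N + length xs * N) = Suc d * length xs * N"
  proof -
    have "d * a * N + (d * b * N + (a + b) * N) = Suc d * (a + b) * N" for a b
      by (simp add: algebra_simps)
    from this[of "length ?ys" "length ?zs", unfolded total] show ?thesis .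
  qed
  moreover have "real (d * length ?ys) * \<delta> + (real (d * length ?zs) * \<delta> + real (length xs) * \<delta>)
     = real (Suc d * length xs) * \<delta>"
  proof -
    have "real (d * a) * \<delta> + (real (d * b) * \<delta> + real (a + b) * \<delta>) = real (Suc d * (a + b)) * \<delta>" for a b
      by (simp add: algebra_simps)
    from this[of "length ?ys" "length ?zs", unfolded total] show ?thesis .
  qed
  ultimately show ?case by simp
qed

text \<open>Two pigeonhole arguments. \<open>T\<close> does not fit into the first
  \<open>k - 1\<close> positions, so some top item stands at or after the pivot and the pivot cannot
  be much lighter than it. The first \<open>k\<close> positions do not fit into
  \<open>T - {t0}\<close>, so one of them holds an item no heavier than \<open>t0\<close>, and the
  pivot cannot be much heavier than that.\<close>

lemma roughly_sorted_nth:
  assumes \<alpha>: "1 \<le> \<alpha>" and sorted: "roughly_sorted w \<alpha> zs" and dist: "distinct zs" and nn: "\<And>z. z \<in> set zs \<Longrightarrow> 0 < w z"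
    and T: "T \<subseteq> set zs" "card T = k" "1 \<le> k" and t0: "t0 \<in> T" "\<And>t. t \<in> T \<Longrightarrow> w t0 \<le> w t"
    and B: "\<And>b. b \<in> set zs - T \<Longrightarrow> w b \<le> w t0"
  shows "zs ! (k - 1) \<in> set zs" "w t0 \<le> \<alpha> * w (zs ! (k - 1))" "w (zs ! (k - 1)) \<le> \<alpha> * w t0"
proof -
  have fin: "finite T" using T finite_subset by blast
  have "k \<le> length zs" using T dist by (metis card_mono distinct_card List.finite_set)
  then have kl: "k - 1 < length zs" using T by linarith
  let ?p = "zs ! (k - 1)"
  show p: "?p \<in> set zs" using kl by simp
  have above: "w ?p \<le> \<alpha> * w (zs ! i)" if "i < k" for i
  proof (cases "i = k - 1")
    case True
    then show ?thesis using nn[OF p] \<alpha> mult_right_mono[of 1 \<alpha> "w ?p"] by simp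
  next
    case False
    then have "i < k - 1" using that by linarith
    then show ?thesis using sorted kl unfolding roughly_sorted_def
      by (simp add: sorted_wrt_iff_nth_less)
  qed
  have below: "w (zs ! i) \<le> \<alpha> * w ?p" if "k - 1 \<le> i" "i < length zs" for i
  proof (cases "i = k - 1")
    case True
    then show ?thesis using nn[OF p] \<alpha> mult_right_mono[of 1 \<alpha> "w ?p"] by simp
  next
    case False
    then have "k - 1 < i" using that by linarith
    then show ?thesis using sorted that unfolding roughly_sorted_def
      by (simp add: sorted_wrt_iff_nth_less)
  qed
  show "w t0 \<le> \<alpha> * w ?p"
  proof -
    have "\<not> T \<subseteq> set (take (k - 1) zs)"
    proof
      assume "T \<subseteq> set (take (k - 1) zs)"
      then have "card T \<le> card (set (take (k - 1) zs))" by (intro card_mono) auto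
      also have "\<dots> \<le> k - 1" using card_length[of "take (k - 1) zs"] by simp
      finally show False using T by linarith
    qed
    then obtain t where t: "t \<in> T" "t \<notin> set (take (k - 1) zs)" by blast
    obtain i where i: "i < length zs" "zs ! i = t" using t T by (metis in_set_conv_nth subsetD)
    have "k - 1 \<le> i"
    proof (rule ccontr)
      assume "\<not> k - 1 \<le> i"
      then have "t \<in> set (take (k - 1) zs)"
        using i kl by (auto simp: in_set_conv_nth intro!: exI[of _ i])
      then show False using t by blast
    qed
    then show ?thesis using below[of i] i t0(2)[OF t(1)] by simp
  qed
  show "w ?p \<le> \<alpha> * w t0"
  proof -
    have "\<exists>i<k. zs ! i \<notin> T - {t0}"
    proof (rule ccontr)
      assume "\<not> ?thesis"
      then have "(!) zs ` {..<k} \<subseteq> T - {t0}" by auto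
      then have "card ((!) zs ` {..<k}) \<le> card (T - {t0})" using fin by (intro card_mono) auto
      moreover have "card ((!) zs ` {..<k}) = k"
        using dist kl T by (subst card_image) (auto simp: inj_on_def nth_eq_iff_index_eq)
      moreover have "card (T - {t0}) = k - 1" using fin t0 T by simp
      ultimately show False using T by linarith
    qed
    then obtain i where i: "i < k" "zs ! i \<notin> T - {t0}" by blast
    have "zs ! i \<in> set zs" using i kl by (intro nth_mem) linarith
    then have "w (zs ! i) \<le> w t0" using i B by auto
    then have "\<alpha> * w (zs ! i) \<le> \<alpha> * w t0" using \<alpha> by (intro mult_left_mono) auto
    then show ?thesis using above[OF i(1)] by linarith
  qed
qed


section \<open>Elimination rounds\<close>

text \<open>With estimates accurate up to \<epsilon>, a difference above
  \<open>2 * \<epsilon>\<close> is certain. The counted set contains \<open>i\<close> itself and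
  everything that might be as good as \<open>i\<close>; \<open>rejected\<close> counts what is
  certainly better.\<close>

definition accepted :: "(nat \<Rightarrow> real) \<Rightarrow> real \<Rightarrow> nat \<Rightarrow> nat list \<Rightarrow> nat \<Rightarrow> bool" where
  "accepted f \<epsilon> k U i \<longleftrightarrow> card {j \<in> set U. f i \<le> f j + 2 * \<epsilon>} \<le> k"

definition rejected :: "(nat \<Rightarrow> real) \<Rightarrow> real \<Rightarrow> nat \<Rightarrow> nat list \<Rightarrow> nat \<Rightarrow> bool" where
  "rejected f \<epsilon> k U i \<longleftrightarrow> k \<le> card {j \<in> set U. f i + 2 * \<epsilon> < f j}"

text \<open>Soundness uses that two errors of \<epsilon> are covered by the margin
  \<open>2 * \<epsilon>\<close> of the tests. For a guaranteed decision the true gap must exceed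
  this margin plus both errors, hence \<open>4 * \<epsilon>\<close>.\<close>

lemma elimination_step:
  fixes v f :: "nat \<Rightarrow> real"
  assumes close: "\<And>i. i \<in> set U \<Longrightarrow> \<bar>f i - v i\<bar> \<le> \<epsilon>"
    and T: "T \<subseteq> set U"
    and sep: "\<And>t b. t \<in> T \<Longrightarrow> b \<in> set U - T \<Longrightarrow> v b < v t"
    and i: "i \<in> set U"
  shows "accepted f \<epsilon> (card T) U i \<Longrightarrow> i \<in> T"
    and "rejected f \<epsilon> (card T) U i \<Longrightarrow> i \<notin> T"
    and "i \<in> T \<Longrightarrow> (\<And>b. b \<in> set U - T \<Longrightarrow> 4 * \<epsilon> < v i - v b) \<Longrightarrow> accepted f \<epsilon> (card T) U i"
    and "i \<notin> T \<Longrightarrow> (\<And>t. t \<in> T \<Longrightarrow> 4 * \<epsilon> < v t - v i) \<Longrightarrow> rejected f \<epsilon> (card T) U i"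
proof -
  have fin: "finite T" using T finite_subset by blast
  show "i \<in> T" if "accepted f \<epsilon> (card T) U i"
  proof (rule ccontr)
    assume "i \<notin> T"
    have "insert i T \<subseteq> {j \<in> set U. f i \<le> f j + 2 * \<epsilon>}"
    proof
      fix j assume j: "j \<in> insert i T"
      then have jU: "j \<in> set U" using T i by auto
      have "v i \<le> v j" using j sep[of j i] \<open>i \<notin> T\<close> i by (auto intro: less_imp_le)
      then show "j \<in> {j \<in> set U. f i \<le> f j + 2 * \<epsilon>}"
        using close[OF jU] close[OF i] jU by auto
    qed
    then have "card (insert i T) \<le> card {j \<in> set U. f i \<le> f j + 2 * \<epsilon>}" by (intro card_mono) auto
    then show False using that \<open>i \<notin> T\<close> fin by (simp add: accepted_def)
  qed
  show "i \<notin> T" if "rejected f \<epsilon> (card T) U i"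
  proof
    assume "i \<in> T"
    have "{j \<in> set U. f i + 2 * \<epsilon> < f j} \<subseteq> T - {i}"
    proof
      fix j assume j: "j \<in> {j \<in> set U. f i + 2 * \<epsilon> < f j}"
      then have "v i < v j" using close[of j] close[OF i] by auto
      then show "j \<in> T - {i}" using sep[OF \<open>i \<in> T\<close>, of j] j by auto
    qed
    then have "card {j \<in> set U. f i + 2 * \<epsilon> < f j} \<le> card (T - {i})"
      using fin by (intro card_mono) auto
    also have "\<dots> < card T" using fin \<open>i \<in> T\<close> by (intro psubset_card_mono) auto
    finally show False using that by (simp add: rejected_def)
  qed
  show "accepted f \<epsilon> (card T) U i" if "i \<in> T" "\<And>b. b \<in> set U - T \<Longrightarrow> 4 * \<epsilon> < v i - v b"
  proof -
    have "{j \<in> set U. f i \<le> f j + 2 * \<epsilon>} \<subseteq> T"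
    proof
      fix j assume j: "j \<in> {j \<in> set U. f i \<le> f j + 2 * \<epsilon>}"
      then have "v i - v j \<le> 4 * \<epsilon>" using close[of j] close[OF i] by auto
      then show "j \<in> T" using that(2)[of j] j by force
    qed
    then show ?thesis using fin by (simp add: accepted_def card_mono)
  qed
  show "rejected f \<epsilon> (card T) U i" if "i \<notin> T" "\<And>t. t \<in> T \<Longrightarrow> 4 * \<epsilon> < v t - v i"
  proof -
    have "T \<subseteq> {j \<in> set U. f i + 2 * \<epsilon> < f j}"
    proof
      fix j assume j: "j \<in> T"
      then have jU: "j \<in> set U" using T by auto
      then show "j \<in> {j \<in> set U. f i + 2 * \<epsilon> < f j}"
        using that(2)[OF j] close[OF jU] close[OF i] by auto
    qed
    then show ?thesis by (simp add: rejected_def card_mono)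
  qed
qed

text \<open>For accuracy \<open>\<epsilon> = 1 / 2 ^ r\<close> the tail exponent
  \<open>N * \<epsilon>^2 / 4\<close> becomes at least \<open>H + r\<close>. The summand
  \<open>r\<close> makes the failure probabilities of the rounds summable.\<close>

definition round_samples :: "real \<Rightarrow> nat \<Rightarrow> nat" where
  "round_samples H r = nat \<lceil>4 * 4 ^ r * (H + real r)\<rceil>"

text \<open>
  The first argument is fuel. The query of \<open>{1, 2}\<close> serves only to make every round
  cost at least one comparison, so that fuel \<open>m + 1\<close> is enough for \<open>m\<close> comparisons.
\<close>

primrec eliminate :: "nat \<Rightarrow> nat \<Rightarrow> nat \<Rightarrow> real \<Rightarrow> nat \<Rightarrow> nat \<Rightarrow> nat set \<Rightarrow> nat list \<Rightarrow> nat set prog" where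
  "eliminate 0 n k H p r A U = Ret A"
| "eliminate (Suc F) n k H p r A U = (if U = [] then Ret A else
     Ask (return_pmf {1, 2}) (\<lambda>_. bindp (estimates n (round_samples H r) p U) (\<lambda>f.
       let acc = accepted f (1 / 2 ^ r) (k - card A) U; rej = rejected f (1 / 2 ^ r) (k - card A) U
       in eliminate F n k H p (Suc r) (A \<union> {i \<in> set U. acc i})
            (filter (\<lambda>i. \<not> acc i \<and> \<not> rej i) U))))"

lemma validp_eliminate: "2 \<le> l \<Longrightarrow> 2 \<le> n \<Longrightarrow> validp n l (eliminate F n k H p r A U)"
  by (induction F arbitrary: r A U) (auto simp: Let_def intro!: validp_bind validp_estimates)

lemma agree_eliminate:
  "t < F \<Longrightarrow> t < F' \<Longrightarrow> agree t (eliminate F n k H p r A U) (eliminate F' n k H p r A U)"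
proof (induction t arbitrary: F F' r A U)
  case 0
  then obtain G G' where "F = Suc G" "F' = Suc G'" by (metis less_imp_Suc_add)
  then show ?case by simp
next
  case (Suc t)
  then obtain G G' where F: "F = Suc G" "F' = Suc G'" by (metis less_imp_Suc_add)
  show ?case using Suc unfolding F by (auto simp: Let_def intro!: agree_bind)
qed

text \<open>An item undecided in round \<open>r\<close> has
  \<open>\<gamma> i \<le> 4 / 2 ^ r = 8 / 2 ^ Suc r\<close>, the invariant of the next round; the
  lower bound on \<gamma> empties \<open>U\<close> by round \<open>R\<close>. The invariant gives
  \<open>4 ^ r \<le> 64 / (\<gamma> i)^2\<close>, and an item gets at most
  \<open>5 * 4 ^ r * (H + R)\<close> samples, so 320 = 5 * 64 and the one bound \<open>P\<close>
  serves every round. Round \<open>r\<close> fails with probability at most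
  \<open>2 * n * exp (- H) / 2 ^ r\<close>, a geometric series.\<close>

lemma ok_eliminate:
  fixes w \<gamma> :: "nat \<Rightarrow> real" and H :: real and p P R :: nat and C T :: "nat set"
  defines "v \<equiv> \<lambda>i. w i / (w i + w p)"
  assumes pos: "\<And>i. i \<in> {1..n} \<Longrightarrow> 0 < w i" and p: "p \<in> {1..n}" and H: "1 \<le> H"
    and C: "C \<subseteq> {1..n}" and T: "T \<subseteq> C" "card T = k"
    and \<gamma>0: "\<And>i. i \<in> C \<Longrightarrow> 8 / 2 ^ R < \<gamma> i"
    and \<gamma>: "\<And>t b. t \<in> T \<Longrightarrow> b \<in> C - T \<Longrightarrow> \<gamma> t \<le> v t - v b"
      "\<And>t b. t \<in> T \<Longrightarrow> b \<in> C - T \<Longrightarrow> \<gamma> b \<le> v t - v b"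
    and P: "1 + 320 * (H + R) * (\<Sum>i\<in>C. 1 / (\<gamma> i)\<^sup>2) \<le> P"
    and "r \<le> R" "R \<le> r + F" "distinct U" "A \<subseteq> T" "T \<subseteq> A \<union> set U" "A \<inter> set U = {}" "set U \<subseteq> C"
    and "\<And>i. i \<in> set U \<Longrightarrow> \<gamma> i \<le> 8 / 2 ^ r"
  shows "ok w ((R - r) * P) (4 * real n * exp (- H) / 2 ^ r) (eliminate F n k H p r A U) (\<lambda>X. X = T)"
  using assms(12-19)
proof (induction F arbitrary: r A U)
  case 0
  then have rR: "r = R" by simp
  have "U = []"
  proof (rule ccontr)
    assume "U \<noteq> []"
    then obtain i where i: "i \<in> set U" by (cases U) auto
    then have "\<gamma> i \<le> 8 / 2 ^ R" "i \<in> C" using "0.prems" rR by auto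
    then show False using \<gamma>0[of i] by simp
  qed
  then show ?case using "0.prems" by (auto intro!: ok_Ret)
next
  case (Suc F)
  show ?case
  proof (cases "U = []")
    case True
    then show ?thesis using Suc.prems by (auto intro!: ok_Ret)
  next
    case False
    then obtain i0 where i0: "i0 \<in> set U" by (cases U) auto
    have rR: "r < R"
    proof (rule ccontr)
      assume "\<not> r < R"
      then have "r = R" using Suc.prems by simp
      then show False using i0 Suc.prems \<gamma>0[of i0] by force
    qed
    have \<gamma>pos: "0 < \<gamma> i" if "i \<in> C" for i
      by (rule less_trans[OF _ \<gamma>0[OF that]]) simp
    have four: "((2::real) ^ r)\<^sup>2 = 4 ^ r"
      by (simp add: power2_eq_square flip: power_mult_distrib)
    define \<epsilon> :: real where "\<epsilon> = 1 / 2 ^ r"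
    define N where "N = round_samples H r"
    have \<epsilon>: "0 \<le> \<epsilon>" "\<epsilon> \<le> 1" "\<epsilon>\<^sup>2 = 1 / 4 ^ r"
      by (simp_all add: \<epsilon>_def power_divide four)
    have Nge: "4 * 4 ^ r * (H + real r) \<le> N" unfolding N_def round_samples_def by linarith
    have N0: "0 < N"
    proof -
      have "0 < 4 * 4 ^ r * (H + real r)" using H by simp
      then show ?thesis using Nge by (metis less_le_trans of_nat_0_less_iff)
    qed
    \<comment> \<open>The quantity rounded up is 4 times this one, so the rounding error of at most
      1 is absorbed by replacing 4 with 5.\<close>
    have "1 * 1 \<le> 4 ^ r * (H + real r)"
      using H by (intro mult_mono) auto
    then have Nle: "real N \<le> 5 * 4 ^ r * (H + R)"
    proof -
      have "4 ^ r * (H + real r) \<le> 4 ^ r * (H + R)" using rR by (intro mult_left_mono) auto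
      moreover have "real N < 4 * 4 ^ r * (H + real r) + 1" unfolding N_def round_samples_def
        using \<open>1 * 1 \<le> 4 ^ r * (H + real r)\<close> by linarith
      ultimately show ?thesis using \<open>1 * 1 \<le> 4 ^ r * (H + real r)\<close> by linarith
    qed
    have cost: "1 + length U * N \<le> P"
    proof -
      have g: "4 ^ r \<le> 64 * (1 / (\<gamma> i)\<^sup>2)" if "i \<in> set U" for i
      proof -
        have "0 < \<gamma> i" using Suc.prems that by (intro \<gamma>pos) auto
        moreover have "\<gamma> i * 2 ^ r \<le> 8" using Suc.prems(8)[OF that] by (simp add: field_simps)
        ultimately have "(\<gamma> i * 2 ^ r)\<^sup>2 \<le> 8\<^sup>2" by (intro power_mono) auto
        then have "(\<gamma> i)\<^sup>2 * 4 ^ r \<le> 64" by (simp add: power_mult_distrib four)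
        then show ?thesis using \<open>0 < \<gamma> i\<close> by (simp add: field_simps)
      qed
      have "real (length U) * 4 ^ r = (\<Sum>i\<in>set U. 4 ^ r)"
        using Suc.prems by (simp add: distinct_card)
      also have "\<dots> \<le> (\<Sum>i\<in>set U. 64 * (1 / (\<gamma> i)\<^sup>2))" by (intro sum_mono g)
      also have "\<dots> \<le> (\<Sum>i\<in>C. 64 * (1 / (\<gamma> i)\<^sup>2))"
        using Suc.prems(7) finite_subset[OF C] by (intro sum_mono2) auto
      finally have "real (length U) * 4 ^ r \<le> 64 * (\<Sum>i\<in>C. 1 / (\<gamma> i)\<^sup>2)"
        by (simp add: sum_distrib_left)
      then have "(5 * (H + R)) * (real (length U) * 4 ^ r) \<le> (5 * (H + R)) * (64 * (\<Sum>i\<in>C. 1 / (\<gamma> i)\<^sup>2))"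
        using H by (intro mult_left_mono) auto
      moreover have "real (length U) * real N \<le> real (length U) * (5 * 4 ^ r * (H + R))"
        using Nle by (intro mult_left_mono) auto
      ultimately have "1 + real (length U) * real N \<le> P"
        using P by (simp add: algebra_simps)
      then show ?thesis by (metis of_nat_1 of_nat_add of_nat_le_iff of_nat_mult)
    qed
    let ?\<delta> = "2 * real n * exp (- H) / 2 ^ r" and ?\<delta>' = "4 * real n * exp (- H) / 2 ^ Suc r"
    have "ok w (length U * N) (length U * (2 * exp (- real N * \<epsilon>\<^sup>2 / 4))) (estimates n N p U)
       (\<lambda>f. \<forall>x\<in>set U. \<bar>f x - w x / (w x + w p)\<bar> \<le> \<epsilon>)"
      using pos p N0 \<epsilon> subset_trans[OF Suc.prems(7) C] by (intro ok_estimates) auto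
    then have est: "ok w (length U * N) ?\<delta> (estimates n N p U) (\<lambda>f. \<forall>x\<in>set U. \<bar>f x - v x\<bar> \<le> \<epsilon>)"
    proof (rule ok_mono)
      have "H + real r \<le> real N * \<epsilon>\<^sup>2 / 4"
        using Nge by (simp add: \<epsilon> field_simps)
      then have "exp (- real N * \<epsilon>\<^sup>2 / 4) \<le> exp (- H) * exp (- real r)"
        by (simp flip: exp_add)
      also have "\<dots> \<le> exp (- H) * (1 / 2 ^ r)"
      proof (intro mult_left_mono)
        have "(2::real) ^ r \<le> exp 1 ^ r"
          using exp_ge_add_one_self[of 1] by (intro power_mono) auto
        also have "\<dots> = exp (real r)" by (simp flip: exp_of_nat_mult)
        finally show "exp (- real r) \<le> 1 / 2 ^ r" by (simp add: exp_minus field_simps)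
      qed simp
      finally have "exp (- real N * \<epsilon>\<^sup>2 / 4) \<le> exp (- H) / 2 ^ r"
        by simp
      moreover have "length U \<le> n"
        using card_mono[of "{1..n}" "set U", OF _ subset_trans[OF Suc.prems(7) C]]
          distinct_card[OF Suc.prems(3)] by simp
      ultimately have "real (length U) * (2 * exp (- real N * \<epsilon>\<^sup>2 / 4)) \<le> real n * (2 * (exp (- H) / 2 ^ r))"
        by (intro mult_mono) auto
      then show "length U * (2 * exp (- real N * \<epsilon>\<^sup>2 / 4)) \<le> ?\<delta>" by (simp add: mult_ac)
    qed (auto simp: v_def)
    define next_round where "next_round = (\<lambda>f.
       let acc = accepted f (1 / 2 ^ r) (k - card A) U; rej = rejected f (1 / 2 ^ r) (k - card A) U
       in eliminate F n k H p (Suc r) (A \<union> {i \<in> set U. acc i})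
            (filter (\<lambda>i. \<not> acc i \<and> \<not> rej i) U))"
    have "ok w (length U * N + (R - Suc r) * P) (?\<delta> + ?\<delta>')
      (bindp (estimates n N p U) next_round) (\<lambda>X. X = T)"
    proof (rule ok_bind[OF est])
      fix f assume close: "\<forall>x\<in>set U. \<bar>f x - v x\<bar> \<le> \<epsilon>"
      \<comment> \<open>Accepted items leave \<open>U\<close>, so the tests within \<open>U\<close>
        look for the remaining \<open>k - card A\<close> top items.\<close>
      define T' where "T' = T - A"
      have finT: "finite T" using T C finite_subset by (metis finite_atLeastAtMost)
      have finA: "finite A" using Suc.prems finT finite_subset by blast
      have cardT': "k - card A = card T'"
        using T finA Suc.prems by (simp add: T'_def card_Diff_subset)
      have T'U: "T' \<subseteq> set U" using Suc.prems by (auto simp: T'_def)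
      have UT: "i \<in> T' \<longleftrightarrow> i \<in> T" if "i \<in> set U" for i
        using that Suc.prems by (auto simp: T'_def)
      have sep: "v b < v t" if "t \<in> T'" "b \<in> set U - T'" for t b
      proof -
        have tb: "t \<in> T" "b \<in> C - T" using that UT Suc.prems by (auto simp: T'_def)
        then show ?thesis using \<gamma>(1)[OF tb] \<gamma>pos[of t] T by auto
      qed
      define acc rej where "acc = accepted f \<epsilon> (card T') U" and "rej = rejected f \<epsilon> (card T') U"
      note step = elimination_step[of U f v \<epsilon> T', OF _ T'U sep, folded acc_def rej_def]
      have acc: "i \<in> T" if "i \<in> set U" "acc i" for i
        using step(1)[of i] close that UT by auto
      have rej: "i \<notin> T" if "i \<in> set U" "rej i" for i
        using step(2)[of i] close that UT by auto
      have undecided: "\<gamma> i \<le> 4 * \<epsilon>" if i: "i \<in> set U" "\<not> acc i" "\<not> rej i" for i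
      proof (rule ccontr)
        assume big: "\<not> ?thesis"
        show False
        proof (cases "i \<in> T")
          case True
          have "4 * \<epsilon> < v i - v b" if "b \<in> set U - T'" for b
            using \<gamma>(1)[OF True, of b] that UT Suc.prems big by auto
          then show False using step(3)[of i] close i True UT by auto
        next
          case False
          have "4 * \<epsilon> < v t - v i" if "t \<in> T'" for t
            using \<gamma>(2)[of t i] that False i Suc.prems big by (auto simp: T'_def)
          then show False using step(4)[of i] close i False UT by auto
        qed
      qed
      have "ok w ((R - Suc r) * P) ?\<delta>'
        (eliminate F n k H p (Suc r) (A \<union> {i \<in> set U. acc i}) (filter (\<lambda>i. \<not> acc i \<and> \<not> rej i) U)) (\<lambda>X. X = T)"
      proof (rule Suc.IH)
        show "\<gamma> i \<le> 8 / 2 ^ Suc r" if "i \<in> set (filter (\<lambda>i. \<not> acc i \<and> \<not> rej i) U)" for i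
          using undecided[of i] that by (auto simp: \<epsilon>_def)
      qed (use rR Suc.prems acc rej in auto)
      then show "ok w ((R - Suc r) * P) ?\<delta>' (next_round f) (\<lambda>X. X = T)"
        by (simp add: next_round_def Let_def acc_def rej_def cardT' \<epsilon>_def)
    qed simp
    then have "ok w (Suc (length U * N + (R - Suc r) * P)) (?\<delta> + ?\<delta>')
       (eliminate (Suc F) n k H p r A U) (\<lambda>X. X = T)"
      using False unfolding eliminate.simps next_round_def N_def by (auto intro: ok_Ask)
    then show ?thesis
    proof (rule ok_mono)
      have "R - r = Suc (R - Suc r)" using rR by simp
      then show "Suc (length U * N + (R - Suc r) * P) \<le> (R - r) * P"
        "?\<delta> + ?\<delta>' \<le> 4 * real n * exp (- H) / 2 ^ r"
        using cost by (auto simp: algebra_simps)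
    qed
  qed
qed


section \<open>The complete algorithm\<close>

text \<open>It bounds both kinds of halving: of the query size in the screening and of the candidate
  list in the sort.\<close>

definition depth :: "nat \<Rightarrow> nat" where
  "depth n = nat \<lceil>log 2 n\<rceil>"

lemma depth_bounds:
  assumes "2 \<le> n"
  shows "n \<le> 2 ^ depth n" "1 \<le> depth n" "depth n \<le> n" "real (depth n) \<le> 3 * ln n"
proof -
  have ge: "log 2 n \<le> depth n" unfolding depth_def by linarith
  have le: "real (depth n) \<le> log 2 n + 1"
  proof -
    have "0 \<le> log 2 n" using assms by simp
    then show ?thesis unfolding depth_def by linarith
  qed
  have "real n = 2 powr (log 2 n)" using assms by simp
  also have "\<dots> \<le> 2 powr (real (depth n))" using ge by (intro powr_mono) auto
  also have "\<dots> = 2 ^ depth n" by (simp add: powr_realpow)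
  finally show "n \<le> 2 ^ depth n" by (metis of_nat_le_iff of_nat_numeral of_nat_power)
  have log1: "1 \<le> log 2 n" using assms by (simp add: le_log_iff)
  then show "1 \<le> depth n" using ge by linarith
  have "log 2 n < n" using assms by (simp add: log_less_iff powr_realpow less_exp)
  then show "depth n \<le> n" unfolding depth_def by (simp add: ceiling_le_iff nat_le_iff)
  have "log 2 n * (2 / 3) \<le> log 2 n * ln 2"
    using ln2_ge_two_thirds log1 by (intro mult_left_mono) auto
  also have "\<dots> = ln n" by (simp add: log_def)
  finally show "real (depth n) \<le> 3 * ln n" using le log1 by linarith
qed

text \<open>With accuracy \<open>1 / (8 * depth n)\<close> per comparison the tail exponent
  \<open>N * \<epsilon>^2 / 4\<close> is at least \<open>H\<close>.\<close>

definition sort_samples :: "real \<Rightarrow> nat \<Rightarrow> nat" where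
  "sort_samples H n = nat \<lceil>256 * (real (depth n))\<^sup>2 * H\<rceil>"

definition topk_prog :: "real \<Rightarrow> nat \<Rightarrow> nat \<Rightarrow> nat \<Rightarrow> nat \<Rightarrow> nat set prog" where
  "topk_prog H n k l F =
     bindp (screen (128 * H) n k (depth n) (min l n)) (\<lambda>C.
     bindp (msort n (sort_samples H n) (depth n) C) (\<lambda>zs.
       eliminate F n k H (zs ! (k - 1)) 0 {} C))"

text \<open>The fuel grows with the history, so no bound on the number of comparisons enters the
  algorithm. By \<open>topk_alg_eq\<close> any larger fuel prescribes the same move.\<close>

definition topk_alg :: "real \<Rightarrow> nat \<Rightarrow> nat \<Rightarrow> nat \<Rightarrow> algorithm" where
  "topk_alg H n k l h = act (follow (topk_prog H n k l (Suc (length h))) (answers h))"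

lemma validp_topk_prog: "2 \<le> l \<Longrightarrow> 2 \<le> n \<Longrightarrow> validp n l (topk_prog H n k l F)"
  unfolding topk_prog_def
  by (intro validp_bind validp_screen validp_msort validp_eliminate) auto

lemma valid_topk_alg:
  assumes "2 \<le> l" "2 \<le> n"
  shows "valid_algorithm n l (topk_alg H n k l)"
  unfolding valid_algorithm_def
proof (intro allI impI)
  fix h r S assume S: "Compare r S \<in> set_pmf (topk_alg H n k l h)"
  let ?p = "follow (topk_prog H n k l (Suc (length h))) (answers h)"
  have "validp n l ?p" using assms by (intro validp_follow validp_topk_prog)
  then show "S \<subseteq> {1..n} \<and> 2 \<le> card S \<and> card S \<le> l"
    using S unfolding topk_alg_def by (cases ?p) auto
qed

lemma topk_alg_eq:
  assumes "length h \<le> m"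
  shows "topk_alg H n k l h = act (follow (topk_prog H n k l (Suc m)) (answers h))"
  unfolding topk_alg_def
proof (rule agree_follow[of "length h"])
  show "agree (length h) (topk_prog H n k l (Suc (length h))) (topk_prog H n k l (Suc m))"
    unfolding topk_prog_def using assms by (intro agree_bind agree_eliminate) auto
qed (simp add: answers_def)

text \<open>The exact difference is \<open>p * (x - y) / ((x + p) * (y + p))\<close>, and the two
  factors below are at most \<open>5 * x\<close> and \<open>5 * p\<close>. The ratio
  \<open>x / p\<close> may be arbitrarily large, as it is for top items far above the
  boundary.\<close>

lemma ratio_gap:
  fixes x y p :: real
  assumes "0 < x" "0 < y" "0 < p" "y \<le> x" "y \<le> 4 * p" "p \<le> 4 * x"
  shows "(x - y) / (25 * x) \<le> x / (x + p) - y / (y + p)"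
proof -
  have "x / (x + p) - y / (y + p) = p * (x - y) / ((x + p) * (y + p))"
    using assms by (simp add: field_simps)
  moreover have "(x - y) / (25 * x) = p * (x - y) / ((5 * x) * (5 * p))"
    using assms by (simp add: field_simps)
  moreover have "p * (x - y) / ((5 * x) * (5 * p)) \<le> p * (x - y) / ((x + p) * (y + p))"
    using assms by (intro divide_left_mono mult_mono mult_pos_pos mult_nonneg_nonneg) auto
  ultimately show ?thesis by simp
qed

lemma ratio_mono:
  fixes x y p :: real
  assumes "0 < x" "0 < p" "x \<le> y"
  shows "x / (x + p) \<le> y / (y + p)"
proof -
  have "x * (y + p) \<le> y * (x + p)"
    using assms mult_right_mono[of x y p] by (simp add: algebra_simps)
  then show ?thesis using assms by (simp add: frac_le_eq divide_nonpos_pos)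
qed

text \<open>This is where the cutoff at a factor 2 in \<open>complexity\<close> enters: beyond it
  \<open>x / (x - y) \<le> 2\<close>, so the item costs a constant; within it
  \<open>x \<le> 2 * y\<close> lets \<open>y\<close> replace \<open>x\<close> in the numerator. Both
  cases give 4 * 625 = 2500.\<close>

lemma inverse_gap_square_top:
  fixes x y :: real
  assumes "0 < y" "y < x"
  shows "1 / ((x - y) / (25 * x))\<^sup>2 \<le> 2500 * (1 + (if x \<le> 2 * y then y\<^sup>2 / (y - x)\<^sup>2 else 0))"
proof -
  have e: "1 / ((x - y) / (25 * x))\<^sup>2 = 625 * (x / (x - y))\<^sup>2"
    using assms by (simp add: field_simps power2_eq_square)
  show ?thesis
  proof (cases "x \<le> 2 * y")
    case True
    have "x / (x - y) \<le> 2 * y / (x - y)" using True assms by (intro divide_right_mono) auto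
    then have "(x / (x - y))\<^sup>2 \<le> (2 * y / (x - y))\<^sup>2" using assms by (intro power_mono) auto
    also have "\<dots> = 4 * (y\<^sup>2 / (y - x)\<^sup>2)"
      by (simp add: power_divide power_mult_distrib power2_commute[of x y])
    finally show ?thesis using True unfolding e by simp
  next
    case False
    have "x / (x - y) \<le> 2" using False assms by (simp add: field_simps)
    then have "(x / (x - y))\<^sup>2 \<le> 2\<^sup>2" using assms by (intro power_mono) auto
    then show ?thesis using False unfolding e by simp
  qed
qed

lemma inverse_gap_square_bottom:
  fixes x y :: real
  assumes "0 < y" "y < x"
  shows "1 / ((x - y) / (25 * x))\<^sup>2 \<le> 2500 * (1 + (if x / 2 \<le> y then x\<^sup>2 / (x - y)\<^sup>2 else 0))"
proof -
  have e: "1 / ((x - y) / (25 * x))\<^sup>2 = 625 * (x / (x - y))\<^sup>2"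
    using assms by (simp add: field_simps power2_eq_square)
  show ?thesis
  proof (cases "x / 2 \<le> y")
    case True
    have "0 \<le> x\<^sup>2 / (x - y)\<^sup>2" by simp
    moreover have "625 * z \<le> 2500 * (1 + z)" if "0 \<le> z" for z :: real using that by simp
    ultimately have "625 * (x\<^sup>2 / (x - y)\<^sup>2) \<le> 2500 * (1 + x\<^sup>2 / (x - y)\<^sup>2)" by blast
    then show ?thesis unfolding e unfolding power_divide if_P[OF True] .
  next
    case False
    have "x / (x - y) \<le> 2" using False assms by (simp add: field_simps)
    then have "(x / (x - y))\<^sup>2 \<le> 2\<^sup>2" using assms by (intro power_mono) auto
    then show ?thesis using False unfolding e by simp
  qed
qed

text \<open>The boundary is formed by the lightest top item \<open>t\<close> and the heaviest other
  item \<open>b\<close>. The number \<open>m\<close> bounds the queries of a screening step and also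
  the number of candidates, hence it reappears in the cost of the sort and, through the constant per
  candidate, in the bound \<open>P\<close> for one elimination round.\<close>

lemma ok_topk_prog:
  fixes w :: "nat \<Rightarrow> real" and H M S1 S2 \<Delta> :: real and T :: "nat set" and n k l m P R F t b :: nat
  assumes pos: "\<And>i. i \<in> {1..n} \<Longrightarrow> 0 < w i" and n: "2 \<le> n" and l: "2 \<le> l" and H: "1 \<le> H"
    and T: "T \<subseteq> {1..n}" "card T = k" "t \<in> T" "\<And>i. i \<in> T \<Longrightarrow> w t \<le> w i"
    and b: "b \<in> {1..n} - T" "\<And>i. i \<in> {1..n} - T \<Longrightarrow> w i \<le> w b" and tb: "w b < w t"
  defines "M \<equiv> k + (\<Sum>i\<in>{1..n} - T. w i) / w t"
    and "S1 \<equiv> \<Sum>i\<in>{1..n} - T. if w t / 2 \<le> w i then (w t)\<^sup>2 / (w t - w i)\<^sup>2 else 0"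
    and "S2 \<equiv> \<Sum>i\<in>T. if w i \<le> 2 * w b then (w b)\<^sup>2 / (w b - w i)\<^sup>2 else 0"
    and "\<Delta> \<equiv> (w t - w b) / w t"
  assumes m: "6 * (128 * H) * M + 1 \<le> m" "6 * M \<le> m" "screen_samples (128 * H) n (min l n) \<le> m"
    and R: "200 / \<Delta> < 2 ^ R" "R \<le> F"
    and P: "1 + 320 * (H + R) * (2500 * (m + S1 + S2)) \<le> P"
  shows "ok w (depth n * m + (depth n * m * sort_samples H n + R * P))
     (9 * (real n)\<^sup>2 * exp (- H)) (topk_prog H n k l F) (\<lambda>X. X = T)"
proof -
  let ?d = "depth n" and ?N = "sort_samples H n"
  have finT: "finite T" using T finite_subset by blast
  have k: "1 \<le> k" using T finT by (metis card_0_eq empty_iff not_less_eq_eq One_nat_def le0 le_zero_eq)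
  have tn: "t \<in> {1..n}" using T by auto
  have wt: "0 < w t" and wb: "0 < w b" using pos tn b by auto
  have TB: "w j \<le> w i" if "i \<in> T" "j \<in> {1..n} - T" for i j
    using T(4)[OF that(1)] b(2)[OF that(2)] tb by linarith
  \<comment> \<open>Other top items contribute at most 1 each by the truncation; the remaining items
    are measured against the lightest top item.\<close>
  have mass: "(\<Sum>j\<in>{1..n} - {i}. min 1 (w j / w i)) \<le> M" if i: "i \<in> T" for i
  proof -
    have "{1..n} - {i} = (T - {i}) \<union> ({1..n} - T)" using i T by auto
    then have "(\<Sum>j\<in>{1..n} - {i}. min 1 (w j / w i))
      = (\<Sum>j\<in>T - {i}. min 1 (w j / w i)) + (\<Sum>j\<in>{1..n} - T. min 1 (w j / w i))"
      by (simp only:) (rule sum.union_disjoint, use finT in auto)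
    also have "(\<Sum>j\<in>T - {i}. min 1 (w j / w i)) \<le> (\<Sum>j\<in>T - {i}. 1)" by (intro sum_mono) auto
    also have "\<dots> \<le> k" using finT T by (simp add: card_Diff_subset_Int card_mono flip: T(2))
    also have "(\<Sum>j\<in>{1..n} - T. min 1 (w j / w i)) \<le> (\<Sum>j\<in>{1..n} - T. w j / w t)"
    proof (rule sum_mono)
      fix j assume j: "j \<in> {1..n} - T"
      have "w j / w i \<le> w j / w t"
        using pos[of j] j T(4)[OF i] wt by (intro divide_left_mono) auto
      then show "min 1 (w j / w i) \<le> w j / w t" by simp
    qed
    finally show ?thesis by (simp add: M_def sum_divide_distrib)
  qed
  have d: "n \<le> 2 ^ ?d" "1 \<le> ?d" "?d \<le> n" using depth_bounds[OF n] by auto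
  have stage1: "ok w (?d * m) (real (?d * n) * (3 * exp (- H))) (screen (128 * H) n k ?d (min l n))
     (\<lambda>C. T \<subseteq> set C \<and> set C \<subseteq> {1..n} \<and> distinct C \<and> length C \<le> m)"
  proof -
    have "ok w (?d * m) (real (?d * n) * (3 * exp (- (128 * H) / 128))) (screen (128 * H) n k ?d (min l n))
     (\<lambda>C. T \<subseteq> set C \<and> set C \<subseteq> {1..n} \<and> distinct C \<and> length C \<le> m)"
    proof (rule ok_screen)
      have "min l n \<le> 2 ^ ?d" using d by simp
      also have "\<dots> < 2 ^ Suc ?d" by simp
      finally show "min l n < 2 ^ Suc ?d" .
      show "min l n < 2 \<Longrightarrow> n \<le> m" "1 \<le> min l n" "min l n \<le> n" "0 < 128 * H"
        using n l H by auto
    qed (fact pos T(1) T(2) TB mass m(1) m(2) m(3))+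
    then show ?thesis by simp
  qed
  have N: "256 * (real ?d)\<^sup>2 * H \<le> ?N" unfolding sort_samples_def by linarith
  \<comment> \<open>The factor \<beta> per level compounds to at most \<open>exp 1 \<le> 3\<close>.
    The choice of \<epsilon> is what \<open>ratio_of_estimate\<close> needs for this \<beta>, with
    equality when the depth is 1.\<close>
  define \<epsilon> :: real where "\<epsilon> = 1 / (8 * ?d)"
  define \<beta> :: real where "\<beta> = 1 + 1 / ?d"
  have \<epsilon>: "0 \<le> \<epsilon>" "\<epsilon> \<le> 1" "4 * \<epsilon> * \<beta> \<le> \<beta> - 1" "1 \<le> \<beta>"
    using d by (auto simp: \<epsilon>_def \<beta>_def field_simps)
  have HN: "H \<le> real ?N * \<epsilon>\<^sup>2 / 4"
    using N d by (simp add: \<epsilon>_def field_simps power2_eq_square)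
  have N0: "0 < ?N"
  proof -
    have "0 < 256 * (real ?d)\<^sup>2 * H" using d H by simp
    then have "0 < real ?N" using N by linarith
    then show ?thesis by simp
  qed
  have "\<beta> ^ ?d \<le> exp (1 / ?d) ^ ?d"
    using exp_ge_add_one_self[of "1 / ?d"] by (intro power_mono) (auto simp: \<beta>_def)
  also have "\<dots> = exp 1" using d by (simp flip: exp_of_nat_mult)
  finally have \<beta>3: "\<beta> ^ ?d \<le> 3" using exp_le by linarith
  have \<beta>1: "1 \<le> \<beta> ^ ?d" using \<epsilon> by simp
  have stage2: "ok w (?d * m * ?N) (real (?d * n) * (2 * exp (- H))) (msort n ?N ?d C)
     (\<lambda>zs. mset zs = mset C \<and> roughly_sorted w (\<beta> ^ ?d) zs)"
    if C: "set C \<subseteq> {1..n}" "distinct C" "length C \<le> m" for C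
  proof -
    have Cn: "length C \<le> n"
      using card_mono[of "{1..n}" "set C"] C distinct_card[of C] by simp
    have "ok w (?d * length C * ?N) (real (?d * length C) * (2 * exp (- real ?N * \<epsilon>\<^sup>2 / 4))) (msort n ?N ?d C)
     (\<lambda>zs. mset zs = mset C \<and> roughly_sorted w (\<beta> ^ ?d) zs)"
      using pos N0 \<epsilon> Cn d C by (intro ok_msort) auto
    then show ?thesis
    proof (rule ok_mono)
      show "?d * length C * ?N \<le> ?d * m * ?N" using C by simp
      have "exp (- real ?N * \<epsilon>\<^sup>2 / 4) \<le> exp (- H)" using HN by simp
      moreover have "real (?d * length C) \<le> real (?d * n)"
        unfolding of_nat_le_iff using Cn by simp
      ultimately show "real (?d * length C) * (2 * exp (- real ?N * \<epsilon>\<^sup>2 / 4)) \<le> real (?d * n) * (2 * exp (- H))"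
        by (intro mult_mono) auto
    qed
  qed
  \<comment> \<open>Each item is measured against the boundary item of the other side.
    \<open>ratio_gap\<close> turns this into a gap of win rates, and \<open>ratio_mono\<close>
    extends it from the boundary item to all items of that side.\<close>
  define \<gamma> where "\<gamma> = (\<lambda>i. if i \<in> T then (w i - w b) / (25 * w i) else (w t - w i) / (25 * w t))"
  have wT: "w b < w i" "0 < w i" if "i \<in> T" for i using T(4)[OF that] tb wb by auto
  have wB: "w i < w t" "0 < w i" if "i \<in> {1..n} - T" for i
    using b(2)[OF that] tb pos that by auto
  have \<Delta>: "0 < \<Delta>" using tb wt by (simp add: \<Delta>_def)
  have \<gamma>\<Delta>: "\<Delta> / 25 \<le> \<gamma> i" if "i \<in> {1..n}" for i
  proof (cases "i \<in> T")
    case True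
    have "w b / w i \<le> w b / w t" using T(4)[OF True] wt wb by (intro divide_left_mono) auto
    then show ?thesis using True wT[OF True] wt by (simp add: \<gamma>_def \<Delta>_def diff_divide_distrib)
  next
    case False
    have "w i / w t \<le> w b / w t" using b(2)[of i] that False wt by (intro divide_right_mono) auto
    then show ?thesis using False wt by (simp add: \<gamma>_def \<Delta>_def diff_divide_distrib)
  qed
  have stage3: "ok w (R * P) (4 * n * exp (- H)) (eliminate F n k H (zs ! (k - 1)) 0 {} C) (\<lambda>X. X = T)"
    if C: "T \<subseteq> set C" "set C \<subseteq> {1..n}" "distinct C" "length C \<le> m"
      and zs: "mset zs = mset C" "roughly_sorted w (\<beta> ^ ?d) zs" for C zs
  proof -
    let ?p = "zs ! (k - 1)"
    have set_zs: "set zs = set C" and dist: "distinct zs"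
      using zs C by (metis mset_eq_setD, metis mset_eq_imp_distinct_iff)
    have "0 < w z" if "z \<in> set zs" for z
      using that set_zs C(2) by (intro pos) blast
    moreover have "T \<subseteq> set zs" using C(1) set_zs by simp
    moreover have "w z \<le> w t" if "z \<in> set zs - T" for z
      using that set_zs C(2) by (intro TB[OF T(3)]) blast
    ultimately have near: "?p \<in> set zs" "w t \<le> \<beta> ^ ?d * w ?p" "w ?p \<le> \<beta> ^ ?d * w t"
      using roughly_sorted_nth[OF \<beta>1 zs(2) dist _ _ T(2) k T(3,4)] by blast+
    have pn: "?p \<in> {1..n}" using near(1) set_zs C(2) by blast
    have wp: "0 < w ?p" by (rule pos[OF pn])
    have "\<beta> ^ ?d * w ?p \<le> 3 * w ?p" "\<beta> ^ ?d * w t \<le> 3 * w t"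
      using \<beta>3 wp wt by (auto intro!: mult_right_mono)
    with near pn have p: "?p \<in> {1..n}" "w t \<le> 3 * w ?p" "w ?p \<le> 3 * w t"
      by linarith+
    let ?v = "\<lambda>i. w i / (w i + w ?p)"
    have "ok w ((R - 0) * P) (4 * real n * exp (- H) / 2 ^ 0) (eliminate F n k H ?p 0 {} C) (\<lambda>X. X = T)"
    proof (rule ok_eliminate[where \<gamma> = \<gamma> and C = "set C"])
      show "8 / 2 ^ R < \<gamma> i" if "i \<in> set C" for i
      proof -
        \<comment> \<open>Here 200 = 8 * 25: all gaps are at least
          \<open>\<Delta> / 25\<close>.\<close>
        have "8 / 2 ^ R < \<Delta> / 25" using R(1) \<Delta> by (simp add: field_simps)
        then show ?thesis using \<gamma>\<Delta>[of i] that C by auto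
      qed
      show "\<gamma> i \<le> ?v i - ?v j" if ij: "i \<in> T" "j \<in> set C - T" for i j
      proof -
        have j: "j \<in> {1..n} - T" using ij C by auto
        have "\<gamma> i \<le> ?v i - ?v b"
          using ij wT[OF ij(1)] wb wp tb p T(4)[OF ij(1)]
          by (auto simp: \<gamma>_def intro!: ratio_gap)
        moreover have "?v j \<le> ?v b"
          using wB[OF j] wp b(2)[OF j] by (intro ratio_mono) auto
        ultimately show ?thesis by linarith
      qed
      show "\<gamma> j \<le> ?v i - ?v j" if ij: "i \<in> T" "j \<in> set C - T" for i j
      proof -
        have j: "j \<in> {1..n} - T" using ij C by auto
        have "\<gamma> j \<le> ?v t - ?v j"
          using ij wB[OF j] wt wp p by (auto simp: \<gamma>_def intro!: ratio_gap)
        moreover have "?v t \<le> ?v i"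
          using wt wp T(4)[OF ij(1)] by (intro ratio_mono) auto
        ultimately show ?thesis by linarith
      qed
      show "1 + 320 * (H + R) * (\<Sum>i\<in>set C. 1 / (\<gamma> i)\<^sup>2) \<le> P"
      proof -
        define s1 where "s1 = (\<lambda>i. if w t / 2 \<le> w i then (w t)\<^sup>2 / (w t - w i)\<^sup>2 else 0)"
        define s2 where "s2 = (\<lambda>i. if w i \<le> 2 * w b then (w b)\<^sup>2 / (w b - w i)\<^sup>2 else 0)"
        have split: "set C = T \<union> (set C - T)" using C by auto
        have "(\<Sum>i\<in>set C. 1 / (\<gamma> i)\<^sup>2) = (\<Sum>i\<in>T. 1 / (\<gamma> i)\<^sup>2) + (\<Sum>i\<in>set C - T. 1 / (\<gamma> i)\<^sup>2)"
          by (subst split, rule sum.union_disjoint) (use finT in auto)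
        also have "(\<Sum>i\<in>T. 1 / (\<gamma> i)\<^sup>2) \<le> (\<Sum>i\<in>T. 2500 * (1 + s2 i))"
        proof (rule sum_mono)
          fix i assume i: "i \<in> T"
          show "1 / (\<gamma> i)\<^sup>2 \<le> 2500 * (1 + s2 i)"
            using inverse_gap_square_top[OF wb wT(1)[OF i]] i by (simp add: \<gamma>_def s2_def)
        qed
        also have "(\<Sum>i\<in>set C - T. 1 / (\<gamma> i)\<^sup>2) \<le> (\<Sum>i\<in>set C - T. 2500 * (1 + s1 i))"
        proof (rule sum_mono)
          fix i assume i: "i \<in> set C - T"
          then have "i \<in> {1..n} - T" using C by auto
          from inverse_gap_square_bottom[OF wB(2,1)[OF this]] i
          show "1 / (\<gamma> i)\<^sup>2 \<le> 2500 * (1 + s1 i)" by (simp add: \<gamma>_def s1_def)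
        qed
        also have "(\<Sum>i\<in>T. 2500 * (1 + s2 i)) + (\<Sum>i\<in>set C - T. 2500 * (1 + s1 i))
            = 2500 * (real (card T) + real (card (set C - T)) + sum s1 (set C - T) + sum s2 T)"
          unfolding sum_distrib_left[symmetric] sum.distrib by simp
        also have "real (card T) + real (card (set C - T)) = length C"
          using card_Un_disjoint[of T "set C - T"] finT split distinct_card[OF C(3)] by auto
        also have "sum s1 (set C - T) \<le> S1"
          unfolding S1_def s1_def[symmetric] using C by (intro sum_mono2) (auto simp: s1_def)
        also have "sum s2 T = S2" by (simp add: S2_def s2_def)
        finally have "(\<Sum>i\<in>set C. 1 / (\<gamma> i)\<^sup>2) \<le> 2500 * (m + S1 + S2)" using C by simp
        then have "320 * (H + R) * (\<Sum>i\<in>set C. 1 / (\<gamma> i)\<^sup>2) \<le> 320 * (H + R) * (2500 * (m + S1 + S2))"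
          using H by (intro mult_left_mono) auto
        then show ?thesis using P by linarith
      qed
      show "\<gamma> i \<le> 8 / 2 ^ 0" if "i \<in> set C" for i
      proof (cases "i \<in> T")
        case True
        then show ?thesis using wT[OF True] wb by (simp add: \<gamma>_def field_simps)
      next
        case False
        then have "i \<in> {1..n} - T" using that C by auto
        then show ?thesis using wB[of i] wt False by (simp add: \<gamma>_def field_simps)
      qed
    qed (use pos p H C T R in auto)
    then show ?thesis by simp
  qed
  have "ok w (?d * m + (?d * m * ?N + R * P))
     (real (?d * n) * (3 * exp (- H)) + (real (?d * n) * (2 * exp (- H)) + 4 * n * exp (- H)))
     (topk_prog H n k l F) (\<lambda>X. X = T)"
    unfolding topk_prog_def
  proof (rule ok_bind[OF stage1])
    fix C assume C: "T \<subseteq> set C \<and> set C \<subseteq> {1..n} \<and> distinct C \<and> length C \<le> m"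
    show "ok w (?d * m * ?N + R * P) (real (?d * n) * (2 * exp (- H)) + 4 * n * exp (- H))
      (bindp (msort n ?N ?d C) (\<lambda>zs. eliminate F n k H (zs ! (k - 1)) 0 {} C)) (\<lambda>X. X = T)"
    proof (rule ok_bind[OF stage2])
      fix zs assume "mset zs = mset C \<and> roughly_sorted w (\<beta> ^ ?d) zs"
      then show "ok w (R * P) (4 * n * exp (- H)) (eliminate F n k H (zs ! (k - 1)) 0 {} C) (\<lambda>X. X = T)"
        using C by (intro stage3) auto
    qed (use C in auto)
  qed simp
  then show ?thesis
  proof (rule ok_mono)
    have "real (?d * n) \<le> real (n * n)" using d by (intro of_nat_mono mult_le_mono) auto
    moreover have "real n \<le> real (n * n)" by (intro of_nat_mono) simp
    ultimately have "5 * real (?d * n) + 4 * n \<le> 9 * (real n)\<^sup>2" by (simp add: power2_eq_square)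
    then have "(5 * real (?d * n) + 4 * n) * exp (- H) \<le> 9 * (real n)\<^sup>2 * exp (- H)"
      by (intro mult_right_mono) auto
    then show "real (?d * n) * (3 * exp (- H)) + (real (?d * n) * (2 * exp (- H)) + 4 * n * exp (- H))
       \<le> 9 * (real n)\<^sup>2 * exp (- H)" by (simp add: algebra_simps)
  qed auto
qed


section \<open>Budget and success probability\<close>

text \<open>The dominant power of \<open>L\<close> comes from the sort: one factor from the depth,
  one from \<open>m\<close> and three from the samples per comparison. The elimination needs only
  squares of \<open>L\<close> and \<Lambda>, but \<open>polylog_factor\<close> has a common
  exponent. Smaller powers are absorbed because \<open>L \<ge> 2/3\<close> and
  \<open>\<Lambda> \<ge> 1\<close>.\<close>

lemma topk_budget:
  fixes n l :: nat and a M S1 S2 \<Delta> H L \<Lambda> X B :: real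
  defines "H \<equiv> a * ln n" and "L \<equiv> ln (real n)" and "\<Lambda> \<equiv> 1 + ln (1 / \<Delta>)" and "X \<equiv> n / l + M + S1 + S2"
    and "B \<equiv> 5 + 800000 * (a + 15) * (1024 * a + 2)"
  assumes n: "2 \<le> n" and l: "2 \<le> l" and a: "6 \<le> a" and M: "1 \<le> M" and S: "0 \<le> S1" "0 \<le> S2"
    and \<Delta>: "0 < \<Delta>" "\<Delta> \<le> 1"
  obtains m P R :: nat where
    "6 * (128 * H) * M + 1 \<le> m" "6 * M \<le> m" "screen_samples (128 * H) n (min l n) \<le> m"
    "200 / \<Delta> < 2 ^ R" "1 + 320 * (H + R) * (2500 * (m + S1 + S2)) \<le> P" "1 \<le> P"
    "real (depth n * m + (depth n * m * sort_samples H n + R * P))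
      \<le> (12 * (1024 * a) + 6939 * a * (1024 * a) + 40 * B) * (L ^ 5 * \<Lambda> ^ 5) * X"
proof -
  have "ln 2 \<le> L" unfolding L_def using n by (subst ln_le_cancel_iff) auto
  then have L: "2 / 3 \<le> L" using ln2_ge_two_thirds by linarith
  have HL: "H = a * L" by (simp add: H_def L_def)
  have H: "1 \<le> H" using mult_mono[OF a L] a by (simp add: HL)
  have \<Lambda>: "1 \<le> \<Lambda>" using \<Delta> by (simp add: \<Lambda>_def)
  have X: "1 \<le> X" "M \<le> X" "S1 + S2 \<le> X" "n / l + 1 \<le> X"
  proof -
    have "0 \<le> real n / real l" by simp
    then show "1 \<le> X" "M \<le> X" "S1 + S2 \<le> X" "n / l + 1 \<le> X"
      using M S unfolding X_def by linarith+
  qed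
  have HX: "1 \<le> H * X" using mult_mono[OF H X(1)] H by simp
  define m where "m = nat \<lceil>6 * (128 * H) * X\<rceil> + 1"
  have mge: "6 * (128 * H) * X + 1 \<le> m" unfolding m_def by linarith
  have mle: "m \<le> 1024 * a * L * X"
  proof -
    have "0 \<le> 6 * (128 * H) * X" using H X by simp
    then have "real m \<le> 6 * (128 * H) * X + 2" unfolding m_def by linarith
    also have "\<dots> \<le> 1024 * (H * X)" using HX by (simp add: mult_ac)
    finally show ?thesis by (simp add: HL mult_ac)
  qed
  have m1: "6 * (128 * H) * M + 1 \<le> m"
  proof -
    have "6 * (128 * H) * M \<le> 6 * (128 * H) * X" using H X by (intro mult_left_mono) auto
    then show ?thesis using mge by linarith
  qed
  have m2: "6 * M \<le> m"
  proof -
    have "1 * (6 * M) \<le> (128 * H) * (6 * M)" using H M by (intro mult_right_mono) auto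
    then show ?thesis using m1 by (simp add: mult_ac)
  qed
  have m3: "screen_samples (128 * H) n (min l n) \<le> m"
  proof -
    \<comment> \<open>The summand 1 covers \<open>l > n\<close>, where the query size is cut down to
      \<open>n\<close>; it is paid for by \<open>M \<ge> 1\<close>.\<close>
    have "real n / real (min l n) \<le> n / l + 1" using n l by (auto simp: min_def)
    then have "real n / real (min l n) \<le> X" using X by linarith
    then have "128 * H * (real n / real (min l n)) \<le> 128 * H * X" using H by (intro mult_left_mono) auto
    also have "\<dots> \<le> 6 * (128 * H) * X" using HX by (simp add: mult_ac)
    finally have "128 * H * n / real (min l n) + 1 \<le> m" using mge by simp
    then show ?thesis by linarith
  qed
  define R where "R = nat \<lceil>log 2 (200 / \<Delta>)\<rceil> + 1"
  have R1: "200 / \<Delta> < 2 ^ R"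
  proof -
    have "log 2 (200 / \<Delta>) < R" unfolding R_def by linarith
    then have "200 / \<Delta> < 2 powr R" using \<Delta> by (subst (asm) log_less_iff) auto
    then show ?thesis by (simp add: powr_realpow)
  qed
  have R2: "R \<le> 10 * \<Lambda>"
  proof -
    have "log 2 200 \<le> 8" by (subst log_le_iff) auto
    moreover have "log 2 (200 / \<Delta>) = log 2 200 + log 2 (1 / \<Delta>)"
      using \<Delta> log_mult[of 2 200 "1 / \<Delta>"] by simp
    moreover have "log 2 (1 / \<Delta>) \<le> 3 / 2 * ln (1 / \<Delta>)"
    proof -
      have 0: "0 \<le> log 2 (1 / \<Delta>)" using \<Delta> by simp
      have "log 2 (1 / \<Delta>) * (2 / 3) \<le> log 2 (1 / \<Delta>) * ln 2"
        using ln2_ge_two_thirds 0 by (intro mult_left_mono) auto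
      also have "\<dots> = ln (1 / \<Delta>)" by (simp add: log_def)
      finally show ?thesis by simp
    qed
    moreover have "0 \<le> log 2 (200 / \<Delta>)" using \<Delta> by simp
    then have "real R \<le> log 2 (200 / \<Delta>) + 2" unfolding R_def by linarith
    ultimately have "real R \<le> 10 + 3 / 2 * (\<Lambda> - 1)" by (simp add: \<Lambda>_def)
    also have "\<dots> \<le> 10 * \<Lambda>" using \<Lambda> by (simp add: field_simps)
    finally show ?thesis .
  qed
  define P where "P = nat \<lceil>1 + 320 * (H + R) * (2500 * (m + S1 + S2))\<rceil>"
  have Ppos: "0 \<le> 320 * (H + R) * (2500 * (m + S1 + S2))" using H S by auto
  have P1: "1 + 320 * (H + R) * (2500 * (m + S1 + S2)) \<le> P" unfolding P_def by linarith
  have P2: "1 \<le> P" using P1 Ppos by linarith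
  have L\<Lambda>: "2 / 3 \<le> L * \<Lambda>" using mult_mono[OF L \<Lambda>] L by simp
  have a0: "0 \<le> a" "0 \<le> L" "0 \<le> \<Lambda>" "0 \<le> X" using a L \<Lambda> X by auto
  have P3: "P \<le> B * (L\<^sup>2 * \<Lambda> * X)"
  proof -
    have "real P \<le> 2 + 320 * (H + R) * (2500 * (m + S1 + S2))"
      unfolding P_def using Ppos by linarith
    moreover have "(H + R) * (m + S1 + S2) \<le> ((a + 15) * (L * \<Lambda>)) * ((1024 * a + 2) * (L * X))"
    proof (rule mult_mono)
      have "a * L * 1 \<le> a * L * \<Lambda>" using \<Lambda> a0 by (intro mult_left_mono) auto
      moreover have "2 / 3 * \<Lambda> \<le> L * \<Lambda>" using L a0 by (intro mult_right_mono) auto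
      ultimately show "H + R \<le> (a + 15) * (L * \<Lambda>)" using R2 by (simp add: HL algebra_simps)
      have "2 / 3 * X \<le> L * X" using L a0 by (intro mult_right_mono) auto
      then have "X \<le> 2 * (L * X)" using X by linarith
      moreover have "(1024 * a + 2) * (L * X) = 1024 * a * L * X + 2 * (L * X)"
        by (simp add: algebra_simps)
      ultimately show "m + S1 + S2 \<le> (1024 * a + 2) * (L * X)" using mle X by linarith
    qed (use a0 S in auto)
    moreover have "2 \<le> 5 * (L\<^sup>2 * \<Lambda> * X)"
    proof -
      have "2 / 3 * (2 / 3) * 1 \<le> L * (L * \<Lambda>) * X"
        using L L\<Lambda> X a0 by (intro mult_mono) auto
      then show ?thesis by (simp add: power2_eq_square mult_ac)
    qed
    ultimately show ?thesis by (simp add: B_def algebra_simps power2_eq_square)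
  qed
  let ?d = "depth n" and ?N = "sort_samples H n"
  have d: "1 \<le> real ?d" "real ?d \<le> 3 * L" using depth_bounds[OF n] by (auto simp: L_def)
  have N: "?N \<le> 2313 * a * L ^ 3"
  proof -
    have 1: "1 \<le> (real ?d)\<^sup>2 * H" using mult_mono[of 1 "(real ?d)\<^sup>2" 1 H] d H by simp
    then have "real ?N \<le> 256 * (real ?d)\<^sup>2 * H + 1" unfolding sort_samples_def by linarith
    also have "\<dots> \<le> 257 * ((real ?d)\<^sup>2 * H)" using 1 by linarith
    also have "\<dots> \<le> 257 * ((3 * L)\<^sup>2 * H)"
      using d H by (intro mult_left_mono mult_right_mono power_mono) auto
    finally show ?thesis by (simp add: HL power2_eq_square power3_eq_cube mult_ac)
  qed
  have dm: "real (?d * m) \<le> 3 * (1024 * a) * (L\<^sup>2 * X)"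
  proof -
    have "real ?d * real m \<le> (3 * L) * (1024 * a * L * X)"
      using d mle a0 by (intro mult_mono) auto
    then show ?thesis by (simp add: power2_eq_square mult_ac)
  qed
  have dmN: "real (?d * m * ?N) \<le> 6939 * a * (1024 * a) * (L ^ 5 * X)"
  proof -
    have "real (?d * m) * real ?N \<le> (3 * (1024 * a) * (L\<^sup>2 * X)) * (2313 * a * L ^ 3)"
      using dm N a0 by (intro mult_mono) auto
    also have "\<dots> = 6939 * a * (1024 * a) * ((L\<^sup>2 * L ^ 3) * X)" by (simp add: mult_ac)
    also have "L\<^sup>2 * L ^ 3 = L ^ 5" by (simp flip: power_add)
    finally show ?thesis by simp
  qed
  have RP: "real (R * P) \<le> 10 * B * (L\<^sup>2 * \<Lambda>\<^sup>2 * X)"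
  proof -
    have "real R * real P \<le> (10 * \<Lambda>) * (B * (L\<^sup>2 * \<Lambda> * X))"
      using R2 P3 a0 by (intro mult_mono) auto
    then show ?thesis by (simp add: power2_eq_square mult_ac)
  qed
  have L25: "L\<^sup>2 \<le> 4 * L ^ 5"
  proof -
    have "(2 / 3) ^ 3 \<le> L ^ 3" using L by (intro power_mono) auto
    then have "1 \<le> 4 * L ^ 3" by (simp add: power3_eq_cube)
    then have "L\<^sup>2 * 1 \<le> L\<^sup>2 * (4 * L ^ 3)" by (intro mult_left_mono) auto
    also have "\<dots> = 4 * (L\<^sup>2 * L ^ 3)" by simp
    also have "L\<^sup>2 * L ^ 3 = L ^ 5" by (simp flip: power_add)
    finally show ?thesis by simp
  qed
  define Z where "Z = L ^ 5 * \<Lambda> ^ 5 * X"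
  have B0: "0 \<le> B" using a0 by (simp add: B_def)
  have Z1: "L ^ 5 * X \<le> Z"
    using mult_left_mono[of 1 "\<Lambda> ^ 5" "L ^ 5 * X"] \<Lambda> a0 by (simp add: Z_def mult_ac)
  have Z2: "L\<^sup>2 * X \<le> 4 * Z"
    using mult_right_mono[OF L25, of X] Z1 a0 by simp
  have Z3: "L\<^sup>2 * \<Lambda>\<^sup>2 * X \<le> 4 * Z"
  proof -
    have "\<Lambda>\<^sup>2 \<le> \<Lambda> ^ 5" using \<Lambda> by (intro power_increasing) auto
    then have "L\<^sup>2 * \<Lambda>\<^sup>2 * X \<le> (4 * L ^ 5) * \<Lambda> ^ 5 * X"
      using L25 a0 by (intro mult_right_mono mult_mono) auto
    then show ?thesis by (simp add: Z_def)
  qed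
  have "real (?d * m + (?d * m * ?N + R * P))
     \<le> 3 * (1024 * a) * (4 * Z) + (6939 * a * (1024 * a) * Z + 10 * B * (4 * Z))"
  proof -
    have "3 * (1024 * a) * (L\<^sup>2 * X) \<le> 3 * (1024 * a) * (4 * Z)"
      using Z2 a0 by (intro mult_left_mono) auto
    moreover have "6939 * a * (1024 * a) * (L ^ 5 * X) \<le> 6939 * a * (1024 * a) * Z"
      using Z1 a0 by (intro mult_left_mono) auto
    moreover have "10 * B * (L\<^sup>2 * \<Lambda>\<^sup>2 * X) \<le> 10 * B * (4 * Z)"
      using Z3 B0 by (intro mult_left_mono) auto
    ultimately show ?thesis using dm dmN RP unfolding of_nat_add by linarith
  qed
  also have "\<dots> = (12 * (1024 * a) + 6939 * a * (1024 * a) + 40 * B) * (L ^ 5 * \<Lambda> ^ 5) * X"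
    by (simp add: Z_def algebra_simps)
  finally show ?thesis by (rule that[OF m1 m2 m3 R1 P1 P2])
qed

text \<open>The bound is proved for each labelling separately; the sets drawn in the screening are
  random by themselves. Fuel \<open>Suc m\<close> represents the algorithm on all histories that
  \<open>m\<close> comparisons can produce.\<close>

lemma topk_alg_failure:
  fixes c a C :: real and n k l m :: nat and \<theta> :: "nat \<Rightarrow> real" and \<pi> :: "nat \<Rightarrow> nat"
  assumes inst: "topk_instance n k l \<theta>" and c: "0 < c" and \<pi>: "\<pi> permutes {1..n}"
  defines "a \<equiv> c + 6"
  defines "C \<equiv> 12 * (1024 * a) + 6939 * a * (1024 * a) + 40 * (5 + 800000 * (a + 15) * (1024 * a + 2))"
  defines "m \<equiv> nat \<lfloor>C * polylog_factor 5 n k \<theta> * complexity n k l \<theta>\<rfloor>"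
  shows "emeasure (measure_pmf (run (topk_alg (a * ln n) n k l) (\<theta> \<circ> inv \<pi>) m []))
      {x. x \<noteq> Some (\<pi> ` {1..k})} \<le> ennreal (1 / real n powr c)"
proof -
  have k: "1 \<le> k" "k < n" and l: "2 \<le> l" and \<theta>0: "\<And>i. i \<in> {1..n} \<Longrightarrow> 0 < \<theta> i"
    and \<theta>mono: "\<And>i j. i \<in> {1..n} \<Longrightarrow> j \<in> {1..n} \<Longrightarrow> i \<le> j \<Longrightarrow> \<theta> j \<le> \<theta> i"
    and gap: "\<theta> (k + 1) < \<theta> k"
    using inst unfolding topk_instance_def by blast+
  have n: "2 \<le> n" using k by linarith
  define w where "w = \<theta> \<circ> inv \<pi>"
  have inj: "inj \<pi>" using \<pi> by (rule permutes_inj)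
  have w: "w (\<pi> i) = \<theta> i" for i using inj by (simp add: w_def)
  have img: "\<pi> ` {1..n} = {1..n}" using \<pi> by (rule permutes_image)
  define T where "T = \<pi> ` {1..k}"
  have compl: "{1..n} - T = \<pi> ` {k+1..n}"
  proof -
    have "{1..n} - T = \<pi> ` ({1..n} - {1..k})"
      unfolding T_def using img inj by (metis image_set_diff)
    also have "{1..n} - {1..k} = {k+1..n}" by auto
    finally show ?thesis .
  qed
  have sumB: "(\<Sum>i\<in>{1..n} - T. g (w i)) = (\<Sum>i\<in>{k+1..n}. g (\<theta> i))" for g :: "real \<Rightarrow> real"
    unfolding compl using inj by (subst sum.reindex) (auto simp: w inj_on_def inj_def)
  have sumT: "(\<Sum>i\<in>T. g (w i)) = (\<Sum>i\<in>{1..k}. g (\<theta> i))" for g :: "real \<Rightarrow> real"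
    unfolding T_def using inj by (subst sum.reindex) (auto simp: w inj_on_def inj_def)
  define M where "M = k + (\<Sum>i\<in>{1..n} - T. w i) / w (\<pi> k)"
  define S1 where "S1 = (\<Sum>i\<in>{1..n} - T. if w (\<pi> k) / 2 \<le> w i then (w (\<pi> k))\<^sup>2 / (w (\<pi> k) - w i)\<^sup>2 else 0)"
  define S2 where "S2 = (\<Sum>i\<in>T. if w i \<le> 2 * w (\<pi> (k+1)) then (w (\<pi> (k+1)))\<^sup>2 / (w (\<pi> (k+1)) - w i)\<^sup>2 else 0)"
  define \<Delta> where "\<Delta> = (w (\<pi> k) - w (\<pi> (k+1))) / w (\<pi> k)"
  have X: "complexity n k l \<theta> = n / l + M + S1 + S2"
  proof -
    have "S1 = (\<Sum>i\<in>{i\<in>{k+1..n}. \<theta> i \<ge> \<theta> k / 2}. (\<theta> k)\<^sup>2 / (\<theta> k - \<theta> i)\<^sup>2)"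
      unfolding S1_def w using sumB[of "\<lambda>x. if \<theta> k / 2 \<le> x then (\<theta> k)\<^sup>2 / (\<theta> k - x)\<^sup>2 else 0"]
      by (subst sum.inter_filter) auto
    moreover have "S2 = (\<Sum>i\<in>{i\<in>{1..k}. \<theta> i \<le> 2 * \<theta> (k+1)}. (\<theta> (k+1))\<^sup>2 / (\<theta> (k+1) - \<theta> i)\<^sup>2)"
      unfolding S2_def w using sumT[of "\<lambda>x. if x \<le> 2 * \<theta> (k+1) then (\<theta> (k+1))\<^sup>2 / (\<theta> (k+1) - x)\<^sup>2 else 0"]
      by (subst sum.inter_filter) auto
    moreover have "M = k + (\<Sum>i\<in>{k+1..n}. \<theta> i) / \<theta> k"
      unfolding M_def w using sumB[of "\<lambda>x. x"] by simp
    ultimately show ?thesis by (simp add: complexity_def)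
  qed
  have \<theta>k: "0 < \<theta> k" "0 < \<theta> (k+1)" using \<theta>0 k by auto
  have \<Delta>: "0 < \<Delta>" "\<Delta> \<le> 1" using gap \<theta>k by (auto simp: \<Delta>_def w)
  have poly: "polylog_factor 5 n k \<theta> = ln n ^ 5 * (1 + ln (1 / \<Delta>)) ^ 5"
    by (simp add: polylog_factor_def \<Delta>_def w)
  have M1: "1 \<le> M"
  proof -
    have "0 \<le> (\<Sum>i\<in>{k+1..n}. \<theta> i)" using \<theta>0 by (intro sum_nonneg less_imp_le) auto
    then have "0 \<le> (\<Sum>i\<in>{k+1..n}. \<theta> i) / \<theta> k" using \<theta>k by simp
    then show ?thesis unfolding M_def w using sumB[of "\<lambda>x. x"] k by simp
  qed
  have S: "0 \<le> S1" "0 \<le> S2" unfolding S1_def S2_def by (auto intro!: sum_nonneg)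
  have a6: "6 \<le> a" using c by (simp add: a_def)
  obtain m' P R :: nat where b:
    "6 * (128 * (a * ln n)) * M + 1 \<le> m'" "6 * M \<le> m'" "screen_samples (128 * (a * ln n)) n (min l n) \<le> m'"
    "200 / \<Delta> < 2 ^ R" "1 + 320 * (a * ln n + R) * (2500 * (m' + S1 + S2)) \<le> P" "1 \<le> P"
    "real (depth n * m' + (depth n * m' * sort_samples (a * ln n) n + R * P))
      \<le> C * (ln n ^ 5 * (1 + ln (1 / \<Delta>)) ^ 5) * (n / l + M + S1 + S2)"
    unfolding C_def by (rule topk_budget[OF n l a6 M1 S \<Delta>])
  let ?cost = "depth n * m' + (depth n * m' * sort_samples (a * ln n) n + R * P)"
  have cost: "?cost \<le> m"
    using b(7) unfolding m_def poly X by (simp only: le_nat_floor)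
  \<comment> \<open>A round is charged at least one comparison, so the number of rounds is within
    the budget and hence within the fuel.\<close>
  have "R * 1 \<le> R * P" using b(6) by (intro mult_le_mono) auto
  then have RF: "R \<le> Suc m" using cost by linarith
  have H1: "1 \<le> a * ln n"
  proof -
    have "ln 2 \<le> ln (real n)" using n by (subst ln_le_cancel_iff) auto
    then have "2 / 3 \<le> ln (real n)" using ln2_ge_two_thirds by linarith
    from mult_mono[OF a6 this] show ?thesis using a6 by simp
  qed
  have "ok w ?cost (9 * (real n)\<^sup>2 * exp (- (a * ln n))) (topk_prog (a * ln n) n k l (Suc m)) (\<lambda>X. X = T)"
  proof (rule ok_topk_prog[where t = "\<pi> k" and b = "\<pi> (k+1)" and m = m' and P = P and R = R])
    show "0 < w i" if "i \<in> {1..n}" for i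
    proof -
      have "i \<in> \<pi> ` {1..n}" using that img by simp
      then show ?thesis using \<theta>0 w by auto
    qed
    show "T \<subseteq> {1..n}" using img k unfolding T_def by auto
    show "card T = k" unfolding T_def using inj by (simp add: card_image inj_on_def inj_def)
    show "\<pi> k \<in> T" unfolding T_def using k by auto
    show "w (\<pi> k) \<le> w i" if "i \<in> T" for i
      using that \<theta>mono k unfolding T_def by (auto simp: w)
    show "\<pi> (k + 1) \<in> {1..n} - T" unfolding compl using k by auto
    show "w i \<le> w (\<pi> (k + 1))" if "i \<in> {1..n} - T" for i
      using that \<theta>mono k unfolding compl by (auto simp: w)
    show "w (\<pi> (k + 1)) < w (\<pi> k)" using gap by (simp add: w)
  qed (use n l H1 b RF in \<open>simp_all add: M_def S1_def S2_def \<Delta>_def\<close>)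
  then have "ok w m (9 * (real n)\<^sup>2 * exp (- (a * ln n))) (topk_prog (a * ln n) n k l (Suc m)) (\<lambda>X. X = T)"
    by (rule ok_mono) (use cost in simp_all)
  then have "err w (\<lambda>X. X = T) (topk_prog (a * ln n) n k l (Suc m)) m \<le> ennreal (9 * (real n)\<^sup>2 * exp (- (a * ln n)))"
    unfolding ok_def by simp
  \<comment> \<open>The summand 6 in \<open>a\<close> pays for the union bound:
    \<open>9 * n^2 \<le> 16 * n^2 \<le> n^6\<close> for \<open>n \<ge> 2\<close>.\<close>
  also have "9 * (real n)\<^sup>2 * exp (- (a * ln n)) \<le> 1 / real n powr c"
  proof -
    have "exp (a * ln n) = real n powr (c + 6)" using n by (simp add: a_def powr_def)
    also have "\<dots> = real n powr c * real n ^ 6" using n by (simp add: powr_add)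
    finally have "exp (- (a * ln n)) = 1 / (real n powr c * real n ^ 6)"
      by (simp add: exp_minus inverse_eq_divide)
    moreover have "9 * (real n)\<^sup>2 \<le> real n ^ 6"
    proof -
      have "2 ^ 4 \<le> real n ^ 4" using n by (intro power_mono) auto
      then have "9 * (real n)\<^sup>2 \<le> real n ^ 4 * (real n)\<^sup>2" by (intro mult_right_mono) auto
      then show ?thesis by (simp flip: power_add)
    qed
    ultimately have "9 * (real n)\<^sup>2 * exp (- (a * ln n)) \<le> real n ^ 6 * (1 / (real n powr c * real n ^ 6))"
      by (metis mult_right_mono exp_ge_zero)
    then show ?thesis using n by simp
  qed
  finally have "err w (\<lambda>X. X = T) (topk_prog (a * ln n) n k l (Suc m)) m \<le> ennreal (1 / real n powr c)"
    by (simp add: ennreal_leI)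
  moreover have "emeasure (measure_pmf (run (topk_alg (a * ln n) n k l) w m []))
      {x. \<not> (\<exists>R. x = Some R \<and> R = T)} = err w (\<lambda>X. X = T) (topk_prog (a * ln n) n k l (Suc m)) m"
    using err_run[of "[]" m "topk_alg (a * ln n) n k l" "topk_prog (a * ln n) n k l (Suc m)" w "\<lambda>X. X = T"]
    by (simp add: topk_alg_eq answers_def)
  ultimately show ?thesis by (simp add: w_def T_def)
qed

theorem theorem1:
  fixes c :: real
  assumes "c > 0"
  shows "\<exists>(A :: nat \<Rightarrow> nat \<Rightarrow> nat \<Rightarrow> algorithm) (C :: real) (d :: nat). C > 0 \<and>
     (\<forall>n k l \<theta>. topk_instance n k l \<theta> \<longrightarrow>
        valid_algorithm n l (A n k l) \<and>
        success_prob (A n k l) n k \<theta>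
          (nat \<lfloor>C * polylog_factor d n k \<theta> * complexity n k l \<theta>\<rfloor>)
        \<ge> 1 - 1 / real n powr c)"
proof -
  define a where "a = c + 6"
  define A where "A = (\<lambda>n k l. topk_alg (a * ln (real n)) n k l)"
  define C where "C = 12 * (1024 * a) + 6939 * a * (1024 * a) + 40 * (5 + 800000 * (a + 15) * (1024 * a + 2))"
  have "0 < C" using assms by (auto simp: C_def a_def intro!: add_pos_pos mult_pos_pos)
  moreover have "valid_algorithm n l (A n k l)" if "topk_instance n k l \<theta>" for n k l \<theta>
    unfolding A_def using that by (intro valid_topk_alg) (auto simp: topk_instance_def)
  moreover have "1 - 1 / real n powr c \<le> success_prob (A n k l) n k \<theta>
      (nat \<lfloor>C * polylog_factor 5 n k \<theta> * complexity n k l \<theta>\<rfloor>)" if inst: "topk_instance n k l \<theta>" for n k l \<theta>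
  proof -
    define m where "m = nat \<lfloor>C * polylog_factor 5 n k \<theta> * complexity n k l \<theta>\<rfloor>"
    let ?D = "labelled_run (A n k l) n \<theta> m"
    let ?E = "{(\<pi>, out). out = Some (\<pi> ` {1..k})} :: ((nat \<Rightarrow> nat) \<times> nat set option) set"
    let ?\<delta> = "1 / real n powr c"
    have perms: "set_pmf (pmf_of_set {\<pi>. \<pi> permutes {1..n}}) = {\<pi>. \<pi> permutes {1..n}}"
    proof (rule set_pmf_of_set)
      show "{\<pi>. \<pi> permutes {1..n}} \<noteq> {}" using permutes_id by blast
    qed (simp add: finite_permutations)
    \<comment> \<open>The failure bound is uniform in the labelling, so it survives averaging over
      all of them.\<close>
    have "emeasure ?D (- ?E) = (\<integral>\<^sup>+\<pi>. emeasure (run (A n k l) (\<theta> \<circ> inv \<pi>) m []) {x. x \<noteq> Some (\<pi> ` {1..k})}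
        \<partial>pmf_of_set {\<pi>. \<pi> permutes {1..n}})"
      unfolding labelled_run_def by (simp add: vimage_def)
    also have "\<dots> \<le> (\<integral>\<^sup>+\<pi>. ennreal ?\<delta> \<partial>pmf_of_set {\<pi>. \<pi> permutes {1..n}})"
    proof (rule nn_integral_mono_AE, rule AE_pmfI)
      fix \<pi> assume "\<pi> \<in> set_pmf (pmf_of_set {\<pi>. \<pi> permutes {1..n}})"
      then have "\<pi> permutes {1..n}" using perms by simp
      from topk_alg_failure[OF inst assms this]
      show "emeasure (run (A n k l) (\<theta> \<circ> inv \<pi>) m []) {x. x \<noteq> Some (\<pi> ` {1..k})} \<le> ennreal ?\<delta>"
        by (simp only: A_def m_def C_def a_def)
    qed
    also have "\<dots> = ennreal ?\<delta>" by simp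
    finally have "measure_pmf.prob ?D (- ?E) \<le> ?\<delta>"
      by (simp add: measure_pmf.emeasure_eq_measure)
    moreover have "measure_pmf.prob ?D (- ?E) = 1 - measure_pmf.prob ?D ?E"
      using measure_pmf.prob_compl[of ?E ?D] by (simp add: Compl_eq_Diff_UNIV)
    ultimately show ?thesis unfolding success_prob_def m_def by linarith
  qed
  ultimately show ?thesis by blast
qed

end
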